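(* There exist an absolute constant $c>0$ and an integer $n_0$ such that for every integer $n\ge n_0$ the following hold. (i) It is not possible to cover (tile) an $n\times p(n)$ rectangle by non-overlapping Ferrers shapes of size $n$, using each of the $p(n)$ distinct Ferrers shapes of size $n$ exactly once. (ii) Moreover, the maximum fraction of the area of an $n\times p(n)$ rectangle that can be covered by non-overlapping, pairwise distinct Ferrers shapes of size $n$ contained in the rectangle is at most $\frac{c}{\log n}$.
   Context: A partition of a positive integer $n$ is an array $(x_1,\dots,x_k)$ of positive integers with $x_1\ge x_2\ge\cdots\ge x_k$ and $\sum_i x_i=n$; $p(n)$ denotes the number of distinct partitions of $n$. The Ferrers shape of the partition $(x_1,\dots,x_k)$ is the planar region formed by $n$ unit square boxes with sides parallel to the coordinate axes, with $x_i$ boxes in the $i$th row (consecutive rows being adjacent), all rows starting at the same vertical line. Its size is $n$. Ferrers shapes of size $n$ correspond bijectively to partitions of $n$, and "distinct" shapes means shapes of distinct partitions. The rectangle has sides parallel to the coordinate axes and side lengths $n$ and $p(n)$. Shapes are placed in the plane with box sides parallel to the axes; a placed shape may have its apex (the corner of its first row and first column) at any of the four corner positions (i.e. a shape may be rotated by multiples of $90^\circ$ or reflected) and may be translated arbitrarily. Each partition is used at most once. Placed shapes are non-overlapping if their interiors are pairwise disjoint. *)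

theory Defs
  imports "HOL-Analysis.Analysis"
begin

definition partitions :: "nat \<Rightarrow> nat list set" where
  "partitions n = {xs. sorted_wrt (\<ge>) xs \<and> (\<forall>x\<in>set xs. 0 < x) \<and> sum_list xs = n}"

definition num_partitions :: "nat \<Rightarrow> nat" where
  "num_partitions n = card (partitions n)"

text \<open>Finiteness ensures that the cardinality above is a genuine count.\<close>

lemma finite_partitions: "finite (partitions n)"
proof (rule finite_subset)
  have length_le: "length xs \<le> sum_list xs" if "\<forall>x\<in>set xs. 0 < x" for xs :: "nat list"
    using that by (induction xs) auto
  show "partitions n \<subseteq> {xs. set xs \<subseteq> {..n} \<and> length xs \<le> n}"
    using length_le member_le_sum_list by (fastforce simp: partitions_def)
  show "finite {xs. set xs \<subseteq> {..n} \<and> length xs \<le> n}"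
    by (rule finite_lists_length_le) simp
qed

text \<open>The Ferrers shape in a reference position: the apex is the origin, the box in column
  \<open>j\<close> of row \<open>i\<close> (both counted from 0) has its corner nearest to the apex at \<open>(j, i)\<close>.\<close>

definition ferrers_shape :: "nat list \<Rightarrow> (real \<times> real) set" where
  "ferrers_shape xs =
     (\<Union>i<length xs. \<Union>j<xs ! i. cbox (real j, real i) (real j + 1, real i + 1))"

text \<open>The eight symmetries of the square, i.e. the group generated by the rotations by multiples
  of 90 degrees and the reflections that preserve the directions of the box sides.\<close>

definition square_symmetries :: "(real \<times> real \<Rightarrow> real \<times> real) set" where
  "square_symmetries =
     {\<lambda>(x, y). (s * x, t * y) | s t. s \<in> {-1, 1} \<and> t \<in> {-1, 1}} \<union>
     {\<lambda>(x, y). (s * y, t * x) | s t. s \<in> {-1, 1} \<and> t \<in> {-1, 1}}"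

definition is_placement :: "nat list \<Rightarrow> (real \<times> real) set \<Rightarrow> bool" where
  "is_placement xs S \<longleftrightarrow>
     (\<exists>g\<in>square_symmetries. \<exists>v. S = (\<lambda>z. v + g z) ` ferrers_shape xs)"

definition is_rectangle :: "real \<Rightarrow> real \<Rightarrow> (real \<times> real) set \<Rightarrow> bool" where
  "is_rectangle a b R \<longleftrightarrow>
     (\<exists>x y. R = cbox (x, y) (x + a, y + b) \<or> R = cbox (x, y) (x + b, y + a))"

text \<open>A family of placed shapes uses a set \<open>A\<close> of partitions of \<open>n\<close>, each of them once; the copy
  of the shape of \<open>xs \<in> A\<close> is the region \<open>T xs\<close>. Indexing the regions by partitions
  is what makes the shapes pairwise distinct.\<close>

definition nonoverlapping_family ::
    "nat \<Rightarrow> nat list set \<Rightarrow> (nat list \<Rightarrow> (real \<times> real) set) \<Rightarrow> bool" where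
  "nonoverlapping_family n A T \<longleftrightarrow>
     A \<subseteq> partitions n \<and>
     (\<forall>xs\<in>A. is_placement xs (T xs)) \<and>
     (\<forall>xs\<in>A. \<forall>ys\<in>A. xs \<noteq> ys \<longrightarrow> interior (T xs) \<inter> interior (T ys) = {})"

definition is_tiling ::
    "nat \<Rightarrow> (real \<times> real) set \<Rightarrow> (nat list \<Rightarrow> (real \<times> real) set) \<Rightarrow> bool" where
  "is_tiling n R T \<longleftrightarrow>
     nonoverlapping_family n (partitions n) T \<and> (\<Union>xs\<in>partitions n. T xs) = R"

definition is_packing ::
    "nat \<Rightarrow> (real \<times> real) set \<Rightarrow> nat list set \<Rightarrow> (nat list \<Rightarrow> (real \<times> real) set) \<Rightarrow> bool" where
  "is_packing n R A T \<longleftrightarrow> nonoverlapping_family n A T \<and> (\<forall>xs\<in>A. T xs \<subseteq> R)"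

definition covered_fraction ::
    "(real \<times> real) set \<Rightarrow> nat list set \<Rightarrow> (nat list \<Rightarrow> (real \<times> real) set) \<Rightarrow> real" where
  "covered_fraction R A T = measure lborel (\<Union>xs\<in>A. T xs) / measure lborel R"

end

theory Submission
  imports Defs "HOL-Real_Asymp.Real_Asymp"
begin

text \<open>A typical partition of \<open>n\<close> has a largest part and a number of parts of order
  \<open>sqrt n * ln n\<close>, although its shape has area only \<open>n\<close>: it has two thin arms along the axes.
  Arms of shapes with the same orientation block each other, and this wastes most of the plane.
  Write \<open>L\<close> for a small multiple of \<open>sqrt n * ln n\<close> (the \<open>arm\<close> length) and \<open>d\<close> for a small
  multiple of \<open>sqrt n\<close> (the \<open>core\<close>), and call a partition spread if both arms are longer than
  \<open>L\<close> and its shape contains a square of side \<open>d\<close>; its shape then contains the region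
  \<open>hook L d\<close>.

  Geometry. Let two non-overlapping hooks have the same orientation and apexes less than
  \<open>L\<close> apart in each coordinate. If one apex lay to the upper left of the other, the horizontal
  arm of the first would cross the vertical arm of the second. So one apex lies to the upper right
  of the other, and outside its square, whence the sums \<open>x + y\<close> of the apex coordinates differ by
  at least \<open>d\<close> (\<open>disjoint_hooks_far_apart\<close>). A square of side \<open>L\<close> thus contains at most
  \<open>2 * L / d + 1 = O(ln n)\<close> apexes of each orientation, although its area is of order
  \<open>n * (ln n)^2\<close>, and a rectangle of area \<open>n * p(n)\<close> has room for only \<open>O(p(n) / ln n)\<close> spread
  shapes (\<open>card_disjoint_hooks\<close>, \<open>card_placed_hooks\<close>).

  Counting. It remains to see that only \<open>O(p(n) / ln n)\<close> partitions are not spread. Let \<open>q(m)\<close> be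
  the number of partitions of \<open>m\<close> into parts of size at most \<open>K\<close>. Everything is extracted from the
  classical identity \<open>m * q(m) = (\<Sum>k\<le>K. \<Sum>a\<ge>1. k * q(m - a * k))\<close> (\<open>num_le_identity\<close>).
  Keeping few terms, it shows that \<open>q\<close> at least doubles over distances of order \<open>sqrt n\<close>
  (\<open>num_le_doubling\<close>); with this exponential decay, the terms with large \<open>a * k\<close> become
  summable, and the identity also bounds the growth of \<open>q\<close> over a distance of order \<open>sqrt n\<close> by a
  constant factor (\<open>num_le_decay\<close>). Hence, for \<open>K = L\<close>, going back from \<open>n\<close> to \<open>n - 2 * L\<close> costs
  only a small power of \<open>n\<close>, whereas a single extra part in \<open>{L<..2 * L}\<close> can be chosen in
  \<open>L\<close> ways (\<open>one_large_part\<close>); so partitions without a part larger than \<open>L\<close> are rare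
  (\<open>eventually_few_short\<close>). By conjugation the same holds for partitions with at most \<open>L\<close> parts
  (\<open>card_parts_num_le_num_le\<close>). Finally, a partition whose shape contains no large square splits into
  a partition with at most \<open>d\<close> parts and one with parts at most \<open>d\<close>, so there are at most
  \<open>exp (\<epsilon> * sqrt n)\<close> of them, with an \<open>\<epsilon>\<close> below the growth rate of \<open>p(n)\<close>
  (\<open>eventually_few_small_core\<close>).

  Each shape has area \<open>n\<close>, so a packing by \<open>O(p(n) / ln n)\<close> shapes covers a fraction \<open>O(1 / ln n)\<close>.
  A tiling would be a packing that covers the fraction 1.\<close>

section \<open>Partitions as multisets\<close>

definition mpartitions :: "nat \<Rightarrow> nat multiset set" where
  "mpartitions n = {M. 0 \<notin># M \<and> sum_mset M = n}"

definition parts_le :: "nat \<Rightarrow> nat \<Rightarrow> nat multiset set" where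
  "parts_le K n = {M. set_mset M \<subseteq> {1..K} \<and> sum_mset M = n}"

text \<open>The conjugates of the partitions in \<open>parts_le K n\<close>: at most \<open>K\<close> parts instead of parts of
  size at most \<open>K\<close>.\<close>

definition parts_num :: "nat \<Rightarrow> nat \<Rightarrow> nat multiset set" where
  "parts_num K n = {M. 0 \<notin># M \<and> size M \<le> K \<and> sum_mset M = n}"

lemma bij_betw_mset_partitions: "bij_betw mset (partitions n) (mpartitions n)"
proof (rule bij_betwI')
  fix xs ys assume "xs \<in> partitions n" "ys \<in> partitions n"
  hence s: "sorted (rev xs)" "sorted (rev ys)"
    by (auto simp: partitions_def sorted_wrt_rev)
  show "mset xs = mset ys \<longleftrightarrow> xs = ys"
    using properties_for_sort[OF _ s(1), of "rev ys"] properties_for_sort[OF _ s(2), of "rev ys"]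
    by auto
next
  fix xs assume "xs \<in> partitions n"
  thus "mset xs \<in> mpartitions n"
    by (auto simp: partitions_def mpartitions_def sum_mset_sum_list)
next
  fix M assume M: "M \<in> mpartitions n"
  let ?xs = "rev (sorted_list_of_multiset M)"
  have "sorted_wrt (\<ge>) ?xs"
    unfolding sorted_wrt_rev using sorted_sorted_list_of_multiset[of M] by simp
  moreover have "mset ?xs = M" by simp
  moreover have "sum_list ?xs = sum_mset M" by (metis calculation(2) sum_mset_sum_list)
  ultimately have "?xs \<in> partitions n" "M = mset ?xs" using M
    by (auto simp: partitions_def mpartitions_def intro: gr0I)
  thus "\<exists>xs\<in>partitions n. M = mset xs" by blast
qed

lemma finite_mpartitions: "finite (mpartitions n)"
  using bij_betw_mset_partitions finite_partitions by (metis bij_betw_finite)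

lemma card_mpartitions: "card (mpartitions n) = num_partitions n"
  using bij_betw_mset_partitions bij_betw_same_card unfolding num_partitions_def by metis

lemma parts_le_subset: "parts_le K n \<subseteq> mpartitions n"
  by (force simp: parts_le_def mpartitions_def)

lemma parts_num_subset: "parts_num K n \<subseteq> mpartitions n"
  by (auto simp: parts_num_def mpartitions_def)

lemma finite_parts_le: "finite (parts_le K n)"
  using parts_le_subset finite_mpartitions by (metis finite_subset)

lemma finite_parts_num: "finite (parts_num K n)"
  using parts_num_subset finite_mpartitions by (metis finite_subset)

abbreviation num_le :: "nat \<Rightarrow> nat \<Rightarrow> nat" where
  "num_le K n \<equiv> card (parts_le K n)"

lemma num_le_self: "num_le n n = num_partitions n"
proof -
  have "M \<in> parts_le n n" if "M \<in> mpartitions n" for M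
  proof -
    have "1 \<le> x \<and> x \<le> n" if x: "x \<in># M" for x
    proof -
      obtain N where "M = add_mset x N" using x by (metis insert_DiffM)
      thus ?thesis using \<open>M \<in> mpartitions n\<close> by (auto simp: mpartitions_def)
    qed
    thus ?thesis using \<open>M \<in> mpartitions n\<close> by (auto simp: mpartitions_def parts_le_def)
  qed
  hence "parts_le n n = mpartitions n" using parts_le_subset by blast
  thus ?thesis by (simp add: card_mpartitions)
qed

section \<open>The basic identity\<close>

text \<open>Removing \<open>a\<close> copies of \<open>k\<close> from a partition that has them is a bijection.\<close>

lemma card_parts_le_count_ge:
  assumes "1 \<le> k" "k \<le> K" "a * k \<le> n"
  shows "card {M \<in> parts_le K n. a \<le> count M k} = num_le K (n - a * k)"
proof -
  let ?f = "\<lambda>M. M + replicate_mset a k"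
  have "bij_betw ?f (parts_le K (n - a * k)) {M \<in> parts_le K n. a \<le> count M k}"
  proof (rule bij_betw_imageI)
    show "inj_on ?f (parts_le K (n - a * k))" by (auto simp: inj_on_def)
    show "?f ` parts_le K (n - a * k) = {M \<in> parts_le K n. a \<le> count M k}"
    proof (intro equalityI subsetI)
      fix M assume "M \<in> ?f ` parts_le K (n - a * k)"
      then obtain N where "M = ?f N" "set_mset N \<subseteq> {1..K}" "sum_mset N = n - a * k"
        unfolding parts_le_def by blast
      moreover have "set_mset (replicate_mset a k) \<subseteq> {1..K}"
        using assms by (simp add: set_mset_replicate_mset_subset)
      ultimately show "M \<in> {M \<in> parts_le K n. a \<le> count M k}"
        using assms by (simp add: parts_le_def)
    next
      fix M assume M: "M \<in> {M \<in> parts_le K n. a \<le> count M k}"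
      define N where "N = M - replicate_mset a k"
      have N: "M = ?f N" using M
        by (simp add: N_def count_le_replicate_mset_subset_eq subset_mset.diff_add)
      have "sum_mset (?f N) = n" "set_mset (?f N) \<subseteq> {1..K}"
        using M N unfolding parts_le_def by (metis (mono_tags) mem_Collect_eq)+
      hence "sum_mset N + a * k = n" "set_mset N \<subseteq> {1..K}"
 by auto
      hence "N \<in> parts_le K (n - a * k)" by (simp add: parts_le_def)
      thus "M \<in> ?f ` parts_le K (n - a * k)" using N by blast
    qed
  qed
  thus ?thesis by (rule bij_betw_same_card[symmetric])
qed

lemma count_le_div:
  assumes "sum_mset M = (n::nat)" "k \<ge> 1"
  shows "count M k \<le> n div k"
proof -
  have "replicate_mset (count M k) k \<subseteq># M" by (simp flip: count_le_replicate_mset_subset_eq)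
  then obtain N where "M = N + replicate_mset (count M k) k"
    by (metis subset_mset.le_iff_add add.commute)
  hence "sum_mset M = sum_mset (N + replicate_mset (count M k) k)" by simp
  hence "count M k * k \<le> n" using assms by (simp add: sum_mset_replicate_mset)
  thus ?thesis using assms by (simp add: less_eq_div_iff_mult_less_eq)
qed

text \<open>Both sides sum up all parts of all partitions counted by \<open>num_le K n\<close>. On the right, a part \<open>k\<close>
  of multiplicity \<open>c\<close> is counted once for each \<open>a\<close> between 1 and \<open>c\<close>.\<close>

lemma num_le_identity:
  "n * num_le K n = (\<Sum>k=1..K. \<Sum>a=1..n div k. k * num_le K (n - a * k))"
proof -
  have sum_parts: "sum_mset M = (\<Sum>k=1..K. k * count M k)" if "set_mset M \<subseteq> {1..K}" for M
    using that
  proof (induction M)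
    case (add x M)
    have "(\<Sum>k=1..K. k * count (add_mset x M) k) = (\<Sum>k=1..K. k * count M k + (if k = x then k else 0))"
      by (rule sum.cong) auto
    also have "\<dots> = sum_mset M + x" using add by (simp add: sum.distrib)
    finally show ?case by simp
  qed simp
  have "n * num_le K n = (\<Sum>M\<in>parts_le K n. \<Sum>k=1..K. k * count M k)"
    using sum_parts by (subst sum.cong[OF refl, where h = "\<lambda>_. n"]) (auto simp: parts_le_def)
  also have "\<dots> = (\<Sum>k=1..K. \<Sum>M\<in>parts_le K n. k * count M k)"
    by (rule sum.swap)
  also have "\<dots> = (\<Sum>k=1..K. \<Sum>a=1..n div k. k * num_le K (n - a * k))"
  proof (rule sum.cong[OF refl])
    fix k assume k: "k \<in> {1..K}"
    have "(\<Sum>M\<in>parts_le K n. k * count M k)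
        = (\<Sum>M\<in>parts_le K n. \<Sum>a=1..n div k. if a \<le> count M k then k else 0)"
    proof (rule sum.cong[OF refl])
      fix M assume "M \<in> parts_le K n"
      hence "count M k \<le> n div k" using count_le_div k by (auto simp: parts_le_def)
      hence "{a \<in> {1..n div k}. a \<le> count M k} = {1..count M k}" by auto
      thus "k * count M k = (\<Sum>a=1..n div k. if a \<le> count M k then k else 0)"
        by (simp add: sum.If_cases Int_def)
    qed
    also have "\<dots> = (\<Sum>a=1..n div k. \<Sum>M\<in>parts_le K n. if a \<le> count M k then k else 0)"
      by (rule sum.swap)
    also have "\<dots> = (\<Sum>a=1..n div k. k * num_le K (n - a * k))"
    proof (rule sum.cong[OF refl])
      fix a assume "a \<in> {1..n div k}"
      hence "a * k \<le> n" using k by (simp add: less_eq_div_iff_mult_less_eq)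
      hence "card {M \<in> parts_le K n. a \<le> count M k} = num_le K (n - a * k)"
        using k by (intro card_parts_le_count_ge) auto
      thus "(\<Sum>M\<in>parts_le K n. if a \<le> count M k then k else 0) = k * num_le K (n - a * k)"
        by (simp add: sum.If_cases Int_def finite_parts_le)
    qed
    finally show "(\<Sum>M\<in>parts_le K n. k * count M k) = (\<Sum>a=1..n div k. k * num_le K (n - a * k))" .
  qed
  finally show ?thesis .
qed

section \<open>Growth of the number of partitions with bounded parts\<close>

text \<open>Parts equal to 1 can be added.\<close>

lemma num_le_mono:
  assumes "1 \<le> K" "m \<le> n" shows "num_le K m \<le> num_le K n"
proof -
  have "num_le K m = card {M \<in> parts_le K n. n - m \<le> count M 1}"
    using card_parts_le_count_ge[of 1 K "n - m" n] assms by simp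
  also have "\<dots> \<le> num_le K n" by (rule card_mono[OF finite_parts_le]) auto
  finally show ?thesis .
qed

lemma num_le_pos: "1 \<le> K \<Longrightarrow> 1 \<le> num_le K n"
proof -
  assume K: "1 \<le> K"
  have "{#} \<in> parts_le K 0" by (simp add: parts_le_def)
  hence "0 < num_le K 0" using finite_parts_le by (auto simp: card_gt_0_iff)
  thus ?thesis using num_le_mono[OF K, of 0 n] by simp
qed

text \<open>The terms of \<open>num_le_identity\<close> with \<open>a * k \<le> J\<close> alone give this bound: each is at least
  \<open>k * num_le K (m - J)\<close>, and the weights \<open>k\<close> add up to at least half of \<open>J\<^sup>2\<close>.\<close>

lemma num_le_growth:
  assumes "1 \<le> J" "J \<le> K" "J \<le> m"
  shows "J\<^sup>2 * num_le K (m - J) \<le> 2 * m * num_le K m"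
proof -
  have "J\<^sup>2 * num_le K (m - J) = (\<Sum>k=1..J. J * num_le K (m - J))"
    by (simp add: power2_eq_square)
  also have "\<dots> \<le> (\<Sum>k=1..J. 2 * (\<Sum>a=1..J div k. k * num_le K (m - J)))"
  proof (rule sum_mono)
    fix k assume k: "k \<in> {1..J}"
    \<comment> \<open>rounding the quotient down loses at most a factor 2 of \<open>J\<close>\<close>
    have "J div k \<ge> 1" using k by (simp add: div_greater_zero_iff Suc_le_eq)
    hence "k \<le> k * (J div k)" by simp
    moreover have "J mod k < k" using k by simp
    ultimately have "J \<le> 2 * (k * (J div k))"
      using mult_div_mod_eq[of k J] by linarith
    hence "J * num_le K (m - J) \<le> 2 * (k * (J div k)) * num_le K (m - J)" by (rule mult_le_mono1)
    thus "J * num_le K (m - J) \<le> 2 * (\<Sum>a=1..J div k. k * num_le K (m - J))" by (simp add: mult_ac)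
  qed
  also have "\<dots> \<le> (\<Sum>k=1..J. 2 * (\<Sum>a=1..J div k. k * num_le K (m - a * k)))"
  proof (intro sum_mono mult_le_mono2)
    fix k a assume "k \<in> {1..J}" "a \<in> {1..J div k}"
    hence "a * k \<le> J" by (simp add: less_eq_div_iff_mult_less_eq)
    thus "num_le K (m - J) \<le> num_le K (m - a * k)" using assms by (intro num_le_mono) auto
  qed
  also have "\<dots> \<le> (\<Sum>k=1..J. 2 * (\<Sum>a=1..m div k. k * num_le K (m - a * k)))"
    using assms(3) by (intro sum_mono mult_le_mono2 sum_mono2) (auto simp: div_le_mono)
  also have "\<dots> \<le> (\<Sum>k=1..K. 2 * (\<Sum>a=1..m div k. k * num_le K (m - a * k)))"
    using assms(2) by (intro sum_mono2) auto
  also have "\<dots> = 2 * m * num_le K m"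
    using num_le_identity[of m K] by (simp flip: sum_distrib_left)
  finally show ?thesis .
qed

text \<open>For \<open>J\<close> of order \<open>sqrt n\<close> the factor \<open>J\<^sup>2 / (2 * m)\<close> of \<open>num_le_growth\<close> is at least 2.\<close>

lemma num_le_doubling:
  assumes "1 \<le> J" "J \<le> K" "4 * n \<le> J\<^sup>2" "m \<le> n" "i * J \<le> m"
  shows "2 ^ i * num_le K (m - i * J) \<le> num_le K m"
  using assms(5)
proof (induction i)
  case (Suc i)
  define m' where "m' = m - i * J"
  have m': "J \<le> m'" "m' \<le> n" "m' - J = m - Suc i * J" "0 < m'"
    using Suc.prems assms by (auto simp: m'_def)
  have "4 * m' * num_le K (m' - J) \<le> J\<^sup>2 * num_le K (m' - J)"
    using assms(3) m'(2) by (intro mult_le_mono1) linarith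
  also have "\<dots> \<le> 2 * m' * num_le K m'"
    using assms m'(1) by (intro num_le_growth)
  finally have "2 * num_le K (m' - J) \<le> num_le K m'" using m'(4) by simp
  hence "2 ^ i * (2 * num_le K (m' - J)) \<le> 2 ^ i * num_le K m'" by (rule mult_le_mono2)
  also have "\<dots> \<le> num_le K m" using Suc by (simp add: m'_def)
  finally show ?case by (simp add: m'(3) mult_ac)
qed simp

text \<open>The weights in \<open>num_le_identity\<close> of the pairs below the hyperbola \<open>a * k = X\<close>: each of the at
  most \<open>X\<close> values of \<open>k\<close> contributes \<open>k * (X div k) \<le> X\<close>.\<close>

lemma sum_rectangle_weights:
  "(\<Sum>k=1..K. \<Sum>a=1..m div k. if a * k \<le> X then k else 0) \<le> X\<^sup>2" for X :: nat
proof -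
  have "(\<Sum>a=1..m div k. if a * k \<le> X then k else 0) \<le> (if k \<le> X then X else 0)"
    if "k \<in> {1..K}" for k
  proof -
    have sub: "{a \<in> {1..m div k}. a * k \<le> X} \<subseteq> {1..X div k}"
      using that by (auto simp: less_eq_div_iff_mult_less_eq)
    have "(\<Sum>a=1..m div k. if a * k \<le> X then k else 0) = card {a \<in> {1..m div k}. a * k \<le> X} * k"
      by (simp add: sum.If_cases Int_def)
    also have "\<dots> \<le> (X div k) * k"
      using card_mono[OF _ sub] by (intro mult_le_mono1) simp
    also have "\<dots> \<le> (if k \<le> X then X else 0)" by simp
    finally show ?thesis .
  qed
  hence "(\<Sum>k=1..K. \<Sum>a=1..m div k. if a * k \<le> X then k else 0) \<le> (\<Sum>k=1..K. if k \<le> X then X else 0)"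
    by (rule sum_mono)
  also have "\<dots> = card {k \<in> {1..K}. k \<le> X} * X" by (simp add: sum.If_cases Int_def)
  also have "\<dots> \<le> card {1..X} * X" by (intro mult_le_mono1 card_mono) auto
  finally show ?thesis by (simp add: power2_eq_square)
qed

lemma sum_squares_over_powers:
  "(\<Sum>i<N. (real i + 2)\<^sup>2 / 2 ^ i) = 22 - (2 * (real N)\<^sup>2 + 12 * real N + 22) / 2 ^ N"
proof (induction N)
  case (Suc N)
  have "22 - (2 * (real N)\<^sup>2 + 12 * real N + 22) / 2 ^ N + (real N + 2)\<^sup>2 / 2 ^ N
      = 22 - (2 * (real (Suc N))\<^sup>2 + 12 * real (Suc N) + 22) / 2 ^ Suc N"
    by (simp add: field_simps power2_eq_square)
  thus ?case by (simp only: sum.lessThan_Suc Suc.IH)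
qed simp

text \<open>This is an upper bound for \<open>num_le K m / num_le K (m - s)\<close>, of constant size when \<open>J\<close> and \<open>s\<close> are
  of order \<open>sqrt m\<close> and \<open>s\<^sup>2\<close> is smaller than \<open>m\<close> by a constant factor. In \<open>num_le_identity\<close>,
  the terms with \<open>a * k \<le> s\<close> contribute at most \<open>s\<^sup>2 * num_le K m\<close>. The others are compared with
  \<open>num_le K (m - s)\<close>: \<open>num_le_doubling\<close> makes them decay like \<open>2 ^ (- a * k / J)\<close>, so their
  weights add up to a multiple of \<open>J\<^sup>2\<close>. The constant 22 is the value of the series
  \<open>\<Sum>i. (i + 2)\<^sup>2 / 2 ^ i\<close>.\<close>

lemma num_le_decay:
  assumes "1 \<le> J" "J \<le> K" "4 * n \<le> J\<^sup>2" "m \<le> n" "s \<le> m" "s \<le> J"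
  shows "(real m - (real s)\<^sup>2) * num_le K m \<le> 22 * (real J)\<^sup>2 * num_le K (m - s)"
proof -
  define w where "w X k a = (if a * k \<le> X then k else 0)" for X k a :: nat
  define q where "q = real (num_le K (m - s))"
  \<comment> \<open>the decaying factor is written as a sum of indicator functions
    of regions below hyperbolas, so that \<open>sum_rectangle_weights\<close> applies to each of them\<close>
  have term_le: "real (k * num_le K (m - a * k))
      \<le> real (w s k a) * num_le K m + (\<Sum>i<Suc m. q / 2 ^ i * w (s + (i + 1) * J) k a)"
    if k: "k \<in> {1..K}" and a: "a \<in> {1..m div k}" for k a
  proof (cases "a * k \<le> s")
    case True
    have "real (num_le K (m - a * k)) \<le> num_le K m" using assms by (simp add: num_le_mono)
    hence "real (k * num_le K (m - a * k)) \<le> real (w s k a) * num_le K m"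
      using True by (simp add: w_def mult_left_mono)
    moreover have "(\<Sum>i<Suc m. q / 2 ^ i * w (s + (i + 1) * J) k a) \<ge> 0"
      by (intro sum_nonneg) (simp add: q_def)
    ultimately show ?thesis by linarith
  next
    case False
    define i where "i = (a * k - s) div J"
    have ak: "a * k \<le> m" using k a by (simp add: less_eq_div_iff_mult_less_eq)
    have iJ: "i * J \<le> a * k - s" by (simp add: i_def)
    have "a * k - s < (i + 1) * J"
      using assms(1) dividend_less_div_times[of J "a * k - s"] by (simp add: i_def)
    hence le: "a * k \<le> s + (i + 1) * J" using False by linarith
    have "i \<le> a * k - s" by (simp add: i_def)
    hence im: "i < Suc m" using ak by linarith
    have "2 ^ i * num_le K (m - a * k) \<le> 2 ^ i * num_le K (m - s - i * J)"
      using iJ ak False assms by (intro mult_le_mono2 num_le_mono) linarith+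
    also have "\<dots> \<le> num_le K (m - s)"
      using iJ ak assms by (intro num_le_doubling[where n = n]) auto
    finally have "2 ^ i * real (num_le K (m - a * k)) \<le> q"
      unfolding q_def by (metis (mono_tags) of_nat_le_iff of_nat_mult of_nat_power of_nat_numeral)
    hence "real (num_le K (m - a * k)) \<le> q / 2 ^ i" by (simp add: field_simps)
    hence "real (num_le K (m - a * k)) * real k \<le> q / 2 ^ i * real k" by (rule mult_right_mono) simp
    hence "real (k * num_le K (m - a * k)) \<le> q / 2 ^ i * w (s + (i + 1) * J) k a"
      unfolding w_def if_P[OF le] by (simp only: of_nat_mult mult.commute)
    also have "\<dots> \<le> (\<Sum>i<Suc m. q / 2 ^ i * w (s + (i + 1) * J) k a)"
      by (rule member_le_sum[where f = "\<lambda>i. q / 2 ^ i * w (s + (i + 1) * J) k a"])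
         (use im in \<open>auto simp: q_def\<close>)
    finally show ?thesis by (simp add: w_def add_increasing)
  qed
  have W: "(\<Sum>k=1..K. \<Sum>a=1..m div k. real (w X k a)) \<le> (real X)\<^sup>2" for X
  proof -
    have "(\<Sum>k=1..K. \<Sum>a=1..m div k. w X k a) \<le> X\<^sup>2"
      unfolding w_def by (rule sum_rectangle_weights)
    hence "real (\<Sum>k=1..K. \<Sum>a=1..m div k. w X k a) \<le> real (X\<^sup>2)" by (rule of_nat_mono)
    thus ?thesis by (simp only: of_nat_sum of_nat_power)
  qed
  have "real (m * num_le K m) = (\<Sum>k=1..K. \<Sum>a=1..m div k. real (k * num_le K (m - a * k)))"
    by (simp only: num_le_identity[of m K] of_nat_sum)
  also have "\<dots> \<le> (\<Sum>k=1..K. \<Sum>a=1..m div k. real (w s k a) * num_le K m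
      + (\<Sum>i<Suc m. q / 2 ^ i * w (s + (i + 1) * J) k a))"
    by (intro sum_mono term_le)
  also have "\<dots> = (\<Sum>k=1..K. \<Sum>a=1..m div k. real (w s k a)) * num_le K m
      + (\<Sum>k=1..K. \<Sum>a=1..m div k. \<Sum>i<Suc m. q / 2 ^ i * w (s + (i + 1) * J) k a)"
    by (simp only: sum.distrib sum_distrib_right)
  also have "(\<Sum>k=1..K. \<Sum>a=1..m div k. \<Sum>i<Suc m. q / 2 ^ i * w (s + (i + 1) * J) k a)
      = (\<Sum>i<Suc m. q / 2 ^ i * (\<Sum>k=1..K. \<Sum>a=1..m div k. real (w (s + (i + 1) * J) k a)))"
    unfolding sum_distrib_left by (subst sum.swap[of _ "{..<Suc m}"]) (simp only: sum.swap[of _ "{..<Suc m}"])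
  also have "\<dots> \<le> (\<Sum>i<Suc m. q / 2 ^ i * ((real i + 2)\<^sup>2 * (real J)\<^sup>2))"
  proof (intro sum_mono mult_left_mono)
    fix i
    have "real (s + (i + 1) * J) \<le> (real i + 2) * real J" using assms(6) by (simp add: algebra_simps)
    hence "(real (s + (i + 1) * J))\<^sup>2 \<le> ((real i + 2) * real J)\<^sup>2" by (intro power_mono) auto
    thus "(\<Sum>k=1..K. \<Sum>a=1..m div k. real (w (s + (i + 1) * J) k a)) \<le> (real i + 2)\<^sup>2 * (real J)\<^sup>2"
      using W[of "s + (i + 1) * J"] by (simp add: power_mult_distrib)
  qed (simp add: q_def)
  also have "\<dots> = q * (real J)\<^sup>2 * (\<Sum>i<Suc m. (real i + 2)\<^sup>2 / 2 ^ i)"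
    by (simp only: sum_distrib_left times_divide_eq_right times_divide_eq_left mult_ac)
  also have "\<dots> \<le> q * (real J)\<^sup>2 * 22"
    unfolding sum_squares_over_powers by (intro mult_left_mono) (auto simp: q_def)
  finally have "real m * num_le K m \<le> (real s)\<^sup>2 * num_le K m + q * (real J)\<^sup>2 * 22"
    using mult_right_mono[OF W[of s], of "real (num_le K m)"] by simp
  thus ?thesis by (simp add: q_def algebra_simps)
qed

text \<open>While at least \<open>n / 2\<close> is left, each step of length \<open>s\<close> costs at most the factor
  \<open>1408 = 4 * 22 * 16\<close>.\<close>

lemma num_le_iterated_decay:
  assumes "1 \<le> J" "J \<le> K" "4 * n \<le> J\<^sup>2" "J\<^sup>2 \<le> 16 * n" "s \<le> J" "4 * s\<^sup>2 \<le> n" "2 * i * s \<le> n"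
  shows "real (num_le K n) \<le> 1408 ^ i * real (num_le K (n - i * s))"
  using assms(7)
proof (induction i)
  case (Suc i)
  define m where "m = n - i * s"
  have le: "i * s \<le> n" using Suc.prems by simp
  have m: "m \<le> n" "s \<le> m" "n \<le> 2 * m" "m - s = n - Suc i * s"
    using Suc.prems le by (auto simp: m_def)
  have n: "n > 0" using assms by (auto intro!: gr0I)
  have "real n / 4 \<le> real m - (real s)\<^sup>2"
  proof -
    have "real (4 * s\<^sup>2) \<le> real n" "real n \<le> real (2 * m)" using assms(6) m(3) of_nat_le_iff by blast+
    thus ?thesis by simp
  qed
  hence "real n / 4 * num_le K m \<le> (real m - (real s)\<^sup>2) * num_le K m"
    by (intro mult_right_mono) auto
  also have "\<dots> \<le> 22 * (real J)\<^sup>2 * num_le K (m - s)"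
    using assms m by (intro num_le_decay[where n = n])
  also have "\<dots> \<le> 22 * (16 * real n) * num_le K (m - s)"
  proof -
    have "real (J\<^sup>2) \<le> real (16 * n)" using assms(4) of_nat_le_iff by blast
    thus ?thesis by (intro mult_right_mono mult_left_mono) auto
  qed
  finally have "real (num_le K m) \<le> 1408 * real (num_le K (m - s))" using n by (simp add: field_simps)
  hence "1408 ^ i * real (num_le K m) \<le> 1408 ^ i * (1408 * real (num_le K (m - s)))" by simp
  moreover have "real (num_le K n) \<le> 1408 ^ i * real (num_le K m)"
    unfolding m_def using Suc.prems by (intro Suc.IH) simp
  ultimately have "real (num_le K n) \<le> 1408 ^ i * (1408 * real (num_le K (n - Suc i * s)))"
    unfolding m(4) by linarith
  thus ?case by (simp add: mult_ac)
qed simp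

text \<open>Adding one part from \<open>{L<..2 * L}\<close> to a partition with parts of size at most \<open>L\<close> is
  injective, since the new part can be recognised by its size.\<close>

lemma one_large_part:
  assumes "2 * L \<le> n" "1 \<le> L"
  shows "L * num_le L (n - 2 * L) \<le> num_partitions n"
proof -
  let ?f = "\<lambda>(j, M). add_mset j M"
  have inj: "inj_on ?f (SIGMA j:{L<..2*L}. parts_le L (n - j))"
  proof (rule inj_onI, clarify)
    fix i j M N
    assume ij: "i \<in> {L<..2*L}" "j \<in> {L<..2*L}" and M: "M \<in> parts_le L (n - i)"
      and N: "N \<in> parts_le L (n - j)" and eq: "add_mset i M = add_mset j N"
    have "i \<notin># N" using ij N by (auto simp: parts_le_def)
    moreover have "i \<in># add_mset j N" by (simp flip: eq)
    ultimately have "i = j" by simp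
    thus "i = j \<and> M = N" using eq by simp
  qed
  have sub: "?f ` (SIGMA j:{L<..2*L}. parts_le L (n - j)) \<subseteq> mpartitions n"
    using assms by (force simp: parts_le_def mpartitions_def)
  have "L * num_le L (n - 2 * L) = (\<Sum>j\<in>{L<..2*L}. num_le L (n - 2 * L))" by simp
  also have "\<dots> \<le> (\<Sum>j\<in>{L<..2*L}. num_le L (n - j))"
    using assms by (intro sum_mono num_le_mono) auto
  also have "\<dots> = card (?f ` (SIGMA j:{L<..2*L}. parts_le L (n - j)))"
    by (simp add: card_image[OF inj] finite_parts_le)
  also have "\<dots> \<le> num_partitions n"
    using card_mono[OF finite_mpartitions sub] by (simp add: card_mpartitions)
  finally show ?thesis .
qed

section \<open>Few parts and small squares\<close>

text \<open>Either no part is equal to \<open>Suc K\<close>, or one such part can be removed.\<close>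

lemma num_le_Suc:
  "num_le (Suc K) n = num_le K n + (if Suc K \<le> n then num_le (Suc K) (n - Suc K) else 0)"
proof -
  let ?B = "{M \<in> parts_le (Suc K) n. 1 \<le> count M (Suc K)}"
  have notin: "M \<in> parts_le K n \<longleftrightarrow> M \<in> parts_le (Suc K) n \<and> \<not> 1 \<le> count M (Suc K)" for M
    by (auto simp: parts_le_def subset_iff le_Suc_eq Suc_le_eq)
  hence "parts_le (Suc K) n = parts_le K n \<union> ?B" "parts_le K n \<inter> ?B = {}" by blast+
  hence "num_le (Suc K) n = num_le K n + card ?B"
    by (metis (no_types, lifting) card_Un_disjoint finite_Un finite_parts_le)
  moreover have "card ?B = (if Suc K \<le> n then num_le (Suc K) (n - Suc K) else 0)"
  proof (cases "Suc K \<le> n")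
    case True
    thus ?thesis using card_parts_le_count_ge[of "Suc K" "Suc K" 1 n] by simp
  next
    case False
    have "count M (Suc K) \<le> 0" if "M \<in> parts_le (Suc K) n" for M
      using count_le_div[of M n "Suc K"] that False by (simp add: parts_le_def)
    hence "?B = {}" by fastforce
    thus ?thesis using False by (simp only: card.empty if_False)
  qed
  ultimately show ?thesis by simp
qed

lemma size_le_sum_mset: "0 \<notin># M \<Longrightarrow> size M \<le> sum_mset (M :: nat multiset)"
  by (induction M) (auto simp: Suc_le_eq add_strict_increasing2)

text \<open>Conjugation, in the form of a recursion: a partition with exactly \<open>Suc K\<close> parts arises by
  increasing all parts of a partition with at most \<open>Suc K\<close> parts (padded by zeros), so \<open>parts_num\<close>
  obeys the recursion \<open>num_le_Suc\<close> as an inequality.\<close>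

lemma card_parts_num_le_num_le: "card (parts_num K n) \<le> num_le K n"
proof (induction K arbitrary: n)
  case 0
  have "parts_num 0 n = parts_le 0 n" by (auto simp: parts_num_def parts_le_def)
  thus ?case by simp
next
  case (Suc K)
  show ?case
  proof (induction n rule: less_induct)
    case (less n)
    let ?B = "{M \<in> parts_num (Suc K) n. size M = Suc K}"
    have "parts_num (Suc K) n = parts_num K n \<union> ?B" by (auto simp: parts_num_def)
    hence "card (parts_num (Suc K) n) \<le> card (parts_num K n) + card ?B"
      using card_Un_le[of "parts_num K n" ?B] by (simp only:)
    also have "card ?B \<le> (if Suc K \<le> n then num_le (Suc K) (n - Suc K) else 0)"
    proof (cases "Suc K \<le> n")
      case False
      hence "?B = {}" using size_le_sum_mset by (fastforce simp: parts_num_def)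
      thus ?thesis using False by (metis card.empty le0)
    next
      case True
      let ?f = "\<lambda>N. image_mset Suc (N + replicate_mset (Suc K - size N) 0)"
      have "?B \<subseteq> ?f ` parts_num (Suc K) (n - Suc K)"
      proof
        fix M assume M: "M \<in> ?B"
        define P where "P = image_mset (\<lambda>x. x - 1) M"
        define N where "N = filter_mset (\<lambda>x. x \<noteq> 0) P"
        have MP: "M = image_mset Suc P"
          unfolding P_def multiset.map_comp
        proof (rule multiset.map_ident_strong[symmetric])
          fix z assume "z \<in># M"
          hence "z \<noteq> 0" using M by (metis (mono_tags) mem_Collect_eq parts_num_def)
          thus "(Suc \<circ> (\<lambda>x. x - 1)) z = z" by simp
        qed
        have "P = N + filter_mset (\<lambda>x. x = 0) P"
          unfolding N_def using multiset_partition[of P "\<lambda>x. x \<noteq> 0"] by simp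
        also have "filter_mset (\<lambda>x. x = 0) P = replicate_mset (count P 0) 0"
          by (rule filter_eq_replicate_mset)
        finally have P: "P = N + replicate_mset (count P 0) 0" .
        have "size P = Suc K" using M by (simp add: P_def)
        hence "count P 0 = Suc K - size N" using arg_cong[OF P, of size] by simp
        hence MN: "M = ?f N" using MP P by simp
        have "sum_mset (image_mset Suc Q) = sum_mset Q + size Q" for Q by (induction Q) auto
        hence "sum_mset M = sum_mset P + size P" using MP by simp
        moreover have "sum_mset P = sum_mset N" using arg_cong[OF P, of sum_mset] by simp
        ultimately have "sum_mset N = n - Suc K" using M \<open>size P = Suc K\<close> by (auto simp: parts_num_def)
        moreover have "size N \<le> Suc K" using arg_cong[OF P, of size] \<open>size P = Suc K\<close> by simp
        moreover have "0 \<notin># N" by (simp add: N_def)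
        ultimately have "N \<in> parts_num (Suc K) (n - Suc K)" by (simp add: parts_num_def)
        thus "M \<in> ?f ` parts_num (Suc K) (n - Suc K)" using MN by blast
      qed
      hence "card ?B \<le> card (parts_num (Suc K) (n - Suc K))"
        by (meson finite_imageI finite_parts_num card_image_le card_mono order.trans)
      also have "\<dots> \<le> num_le (Suc K) (n - Suc K)" using True by (intro less) auto
      finally show ?thesis using True by simp
    qed
    finally show ?case unfolding num_le_Suc[of K n] using Suc[of n] by linarith
  qed
qed

text \<open>With \<open>x = exp (- y)\<close>, this is the bound of a coefficient by the value of the generating
  function: \<open>num_le d m \<le> x ^ (- m) * (\<Prod>k=1..d. 1 / (1 - x ^ k))\<close>, where
  \<open>1 - x ^ k \<ge> y * k / 2\<close> because \<open>y * k \<le> 1\<close>.\<close>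

lemma num_le_exp_bound:
  assumes "0 < y" "y * real d \<le> 1"
  shows "real (num_le d m) \<le> exp (y * real m) * ((2 / y) ^ d / fact d)"
  using assms(2)
proof (induction d arbitrary: m)
  case 0
  have "parts_le 0 m \<subseteq> {{#}}" by (auto simp: parts_le_def)
  hence "num_le 0 m \<le> 1" using card_mono[of "{{#}}" "parts_le 0 m"] by simp
  moreover have "1 \<le> exp (y * real m)" using assms(1) by simp
  ultimately show ?case by (simp add: order.trans[of _ 1])
next
  case (Suc d)
  define F where "F = (\<lambda>k. (2 / y) ^ k / fact k :: real)"
  define u where "u = y * real (Suc d)"
  have u: "0 < u" "u \<le> 1" using assms(1) Suc.prems by (auto simp: u_def)
  have Fpos: "F k > 0" for k using assms(1) by (simp add: F_def)
  have "F (Suc d) = F d * (2 / y) / real (Suc d)" by (simp add: F_def mult_ac)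
  hence FSuc: "F (Suc d) * u = 2 * F d" using assms(1) by (simp add: u_def)
  have "exp (-u) \<le> 1 / (1 + u)" using exp_ge_add_one_self[of u] u by (simp add: exp_minus field_simps)
  also have "\<dots> \<le> 1 - u / 2" using u by (simp add: field_simps)
  finally have "F (Suc d) * exp (-u) \<le> F (Suc d) * (1 - u / 2)" using Fpos by (intro mult_left_mono) (auto simp: less_imp_le)
  hence step: "F d + F (Suc d) * exp (-u) \<le> F (Suc d)" using FSuc by (simp add: algebra_simps)
  have IH: "real (num_le d m) \<le> exp (y * real m) * F d" for m
    unfolding F_def using Suc.prems assms(1) by (intro Suc.IH) (auto simp: algebra_simps)
  have "real (num_le (Suc d) m) \<le> exp (y * real m) * F (Suc d)"
  proof (induction m rule: less_induct)
    case (less m)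
    have "(if Suc d \<le> m then real (num_le (Suc d) (m - Suc d)) else 0) \<le> exp (y * real m) * (F (Suc d) * exp (-u))"
    proof (cases "Suc d \<le> m")
      case True
      have "real (num_le (Suc d) (m - Suc d)) \<le> exp (y * real (m - Suc d)) * F (Suc d)"
        using True by (intro less) auto
      also have "exp (y * real (m - Suc d)) = exp (y * real m) * exp (-u)"
        unfolding exp_add[symmetric] using True by (simp add: u_def of_nat_diff algebra_simps del: of_nat_Suc)
      finally show ?thesis using True by (simp add: mult_ac)
    qed (use Fpos[of "Suc d"] in auto)
    hence "real (num_le (Suc d) m) \<le> exp (y * real m) * F d + exp (y * real m) * (F (Suc d) * exp (-u))"
      unfolding num_le_Suc[of d m] using IH[of m] by (auto split: if_splits)
    also have "\<dots> \<le> exp (y * real m) * F (Suc d)"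
      using step by (simp flip: distrib_left)
    finally show ?case .
  qed
  thus ?case by (simp add: F_def)
qed

text \<open>Split a partition into its at most \<open>d\<close> parts larger than \<open>d\<close> and the rest.\<close>

lemma card_small_durfee:
  "card {M \<in> mpartitions n. size (filter_mset (\<lambda>x. d < x) M) \<le> d} \<le> (\<Sum>j\<le>n. num_le d j * num_le d (n - j))"
proof -
  let ?B = "{M \<in> mpartitions n. size (filter_mset (\<lambda>x. d < x) M) \<le> d}"
  let ?f = "\<lambda>M. (filter_mset (\<lambda>x. d < x) M, filter_mset (\<lambda>x. \<not> d < x) M)"
  let ?C = "\<lambda>j. parts_num d j \<times> parts_le d (n - j)"
  have part: "M = filter_mset (\<lambda>x. d < x) M + filter_mset (\<lambda>x. \<not> d < x) M" for M
    by (rule multiset_partition)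
  have inj: "inj_on ?f ?B"
    by (rule inj_onI) (metis part prod.inject)
  have sub: "?f ` ?B \<subseteq> (\<Union>j\<le>n. ?C j)"
  proof (rule image_subsetI)
    fix M assume "M \<in> ?B"
    hence M: "0 \<notin># M" "sum_mset M = n" "size (filter_mset (\<lambda>x. d < x) M) \<le> d"
      by (simp_all add: mpartitions_def)
    define j where "j = sum_mset (filter_mset (\<lambda>x. d < x) M)"
    have n: "n = j + sum_mset (filter_mset (\<lambda>x. \<not> d < x) M)"
      unfolding j_def sum_mset.union[symmetric] part[symmetric] by (rule M(2)[symmetric])
    have "filter_mset (\<lambda>x. d < x) M \<in> parts_num d j"
      using M by (simp add: parts_num_def j_def)
    moreover have "filter_mset (\<lambda>x. \<not> d < x) M \<in> parts_le d (n - j)"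
      using M(1) by (auto simp: parts_le_def Suc_le_eq n intro!: gr0I)
    ultimately show "?f M \<in> (\<Union>j\<le>n. ?C j)" using n by auto
  qed
  have "card ?B = card (?f ` ?B)" by (rule card_image[OF inj, symmetric])
  also have "\<dots> \<le> card (\<Union>j\<le>n. ?C j)"
    by (rule card_mono[OF _ sub]) (auto intro: finite_parts_le finite_parts_num)
  also have "\<dots> \<le> (\<Sum>j\<le>n. card (?C j))" by (rule card_UN_le) simp
  also have "\<dots> \<le> (\<Sum>j\<le>n. num_le d j * num_le d (n - j))"
    unfolding card_cartesian_product by (intro sum_mono mult_le_mono1 card_parts_num_le_num_le)
  finally show ?thesis .
qed

section \<open>Most partitions have long arms and a large square\<close>

lemma exp_numeric_bounds: "512 \<le> exp (9::real)" "1408 \<le> exp (11::real)" "exp (1/2) \<le> (2::real)"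
proof -
  have e: "2 \<le> exp (1::real)" using exp_ge_add_one_self[of 1] by simp
  have "(2::real) ^ 9 \<le> exp 1 ^ 9" by (rule power_mono[OF e]) simp
  thus "512 \<le> exp (9::real)" by (simp flip: exp_of_nat_mult)
  have "(2::real) ^ 11 \<le> exp 1 ^ 11" by (rule power_mono[OF e]) simp
  thus "1408 \<le> exp (11::real)" by (simp flip: exp_of_nat_mult)
  have "exp (1/2 :: real) ^ 2 = exp 1" by (simp flip: exp_of_nat_mult)
  also have "\<dots> \<le> 2 ^ 2" using exp_le by simp
  finally show "exp (1/2) \<le> (2::real)" by (rule power2_le_imp_le) simp
qed

lemma power_over_fact_le_exp: "0 \<le> x \<Longrightarrow> x ^ d / fact d \<le> exp (x::real)"
proof -
  assume x: "0 \<le> x"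
  have "(\<Sum>k\<in>{d}. inverse (fact k) *\<^sub>R x ^ k) \<le> (\<Sum>k. inverse (fact k) *\<^sub>R x ^ k)"
    by (rule sum_le_suminf[OF summable_exp_generic]) (use x in auto)
  thus ?thesis by (simp add: exp_def field_simps)
qed

text \<open>A distance of order \<open>sqrt n\<close> over which \<open>num_le_doubling\<close> applies to all \<open>m \<le> n\<close>.\<close>

definition doubling_gap :: "nat \<Rightarrow> nat" where
  "doubling_gap n = 2 * nat \<lceil>sqrt (real n)\<rceil>"

lemma doubling_gap_bounds:
  assumes "1 \<le> n"
  shows "1 \<le> doubling_gap n" "4 * n \<le> (doubling_gap n)\<^sup>2" "real (doubling_gap n) \<le> 2 * sqrt n + 2" "(doubling_gap n)\<^sup>2 \<le> 16 * n"
proof -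
  have r: "1 \<le> sqrt (real n)" using assms by simp
  have up: "real (doubling_gap n) \<le> 2 * sqrt n + 2" unfolding doubling_gap_def using r by simp linarith
  have low: "2 * sqrt n \<le> real (doubling_gap n)" unfolding doubling_gap_def using r by simp
  have "(2 * sqrt (real n))\<^sup>2 \<le> (real (doubling_gap n))\<^sup>2" using low by (rule power_mono) simp
  hence "real (4 * n) \<le> real ((doubling_gap n)\<^sup>2)" by (simp add: power_mult_distrib)
  thus "4 * n \<le> (doubling_gap n)\<^sup>2" by (simp only: of_nat_le_iff)
  have "real (doubling_gap n) \<le> 4 * sqrt (real n)" using up r by linarith
  hence "(real (doubling_gap n))\<^sup>2 \<le> (4 * sqrt (real n))\<^sup>2" by (rule power_mono) simp
  hence "real ((doubling_gap n)\<^sup>2) \<le> real (16 * n)" by (simp add: power_mult_distrib)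
  thus "(doubling_gap n)\<^sup>2 \<le> 16 * n" by (simp only: of_nat_le_iff)
  show "1 \<le> doubling_gap n" using low r by linarith
  show "real (doubling_gap n) \<le> 2 * sqrt n + 2" by (rule up)
qed

text \<open>The constant 400 is large enough for the loss in \<open>eventually_few_short\<close> to stay below \<open>sqrt n\<close>,
  and the constant 1000 of \<open>core\<close> for the exponent in \<open>eventually_few_small_core\<close> to stay below
  that of \<open>num_partitions_lower_bound\<close>.\<close>

definition arm :: "nat \<Rightarrow> nat" where
  "arm n = nat \<lfloor>sqrt (real n) * ln (real n) / 400\<rfloor>"

definition core :: "nat \<Rightarrow> nat" where
  "core n = nat \<lfloor>sqrt (real n) / 1000\<rfloor>"

text \<open>By \<open>num_le_iterated_decay\<close> with steps of length about \<open>sqrt n / 2\<close>, passing from \<open>n\<close> to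
  \<open>n - 2 * L\<close> with \<open>L = arm n\<close> costs at most a constant times \<open>n powr (11 / 50)\<close>, while
  \<open>one_large_part\<close> gains the factor \<open>L\<close>, which is larger than \<open>sqrt n\<close>.\<close>

lemma eventually_few_short:
  "eventually (\<lambda>n. ln (real n) * real (num_le (arm n) n) \<le> real (num_partitions n)) sequentially"
proof -
  have "eventually (\<lambda>n. 2 * sqrt (real n) + 2 \<le> sqrt (real n) * ln (real n) / 400 - 1) sequentially"
    "eventually (\<lambda>n. 4 * (sqrt (real n) * ln (real n) / 400) + sqrt (real n) \<le> real n) sequentially"
    "eventually (\<lambda>n. ln (real n) * exp (11 * (ln (real n) / 50 + 1)) \<le> sqrt (real n) * ln (real n) / 400 - 1) sequentially"
    "eventually (\<lambda>n. 4 \<le> sqrt (real n)) sequentially"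
    by real_asymp+
  thus ?thesis
  proof eventually_elim
    case (elim n)
    define r where "r = sqrt (real n)"
    define L where "L = arm n"
    define J where "J = doubling_gap n"
    define s where "s = nat \<lfloor>r / 2\<rfloor>"
    define i where "i = 2 * L div s + 1"
    have r: "4 \<le> r" using elim(4) by (simp add: r_def)
    have n: "1 \<le> n" using elim(4) by (cases n) auto
    have lnn: "0 \<le> ln (real n)" using n by simp
    have L: "real L \<le> r * ln (real n) / 400" "r * ln (real n) / 400 - 1 \<le> real L"
      using lnn r real_of_int_floor_ge_diff_one[of "r * ln (real n) / 400"]
        of_nat_floor[of "r * ln (real n) / 400"]
      unfolding L_def arm_def r_def[symmetric] by (simp_all del: of_nat_nat)
    have s: "real s \<le> r / 2" "r / 4 \<le> real s"
    proof -
      show "real s \<le> r / 2" using r unfolding s_def by (intro of_nat_floor) simp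
      have "r / 2 - 1 \<le> real s" using real_of_int_floor_ge_diff_one[of "r / 2"] r unfolding s_def by simp
      thus "r / 4 \<le> real s" using r by linarith
    qed
    have s0: "0 < s" using s r by linarith
    have J: "1 \<le> J" "4 * n \<le> J\<^sup>2" "real J \<le> 2 * r + 2" "J\<^sup>2 \<le> 16 * n"
      using doubling_gap_bounds[OF n] by (simp_all add: J_def r_def)
    have "real J \<le> real L" using J(3) L elim(1) unfolding r_def by linarith
    hence JL: "J \<le> L" by simp
    have "(2 * r)\<^sup>2 \<le> (real J)\<^sup>2" using J(2) by (simp add: r_def power_mult_distrib flip: of_nat_power)
    hence "2 * r \<le> real J" by (rule power2_le_imp_le) simp
    hence sJ: "s \<le> J" using s r by linarith
    have "(real s)\<^sup>2 \<le> (r / 2)\<^sup>2" using s by (intro power_mono) auto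
    hence "real (4 * s\<^sup>2) \<le> real n" by (simp add: r_def power_divide)
    hence s4: "4 * s\<^sup>2 \<le> n" by (simp only: of_nat_le_iff)
    have "real (4 * L + 2 * s) \<le> real n" using L s elim(2) unfolding r_def by simp
    hence n_ge: "4 * L + 2 * s \<le> n" by (simp only: of_nat_le_iff)
    have i1: "2 * L \<le> i * s" using s0 dividend_less_div_times[of s "2 * L"] by (simp add: i_def)
    have "2 * L div s * s \<le> 2 * L" by simp
    moreover have "2 * i * s = 2 * (2 * L div s * s) + 2 * s" by (simp add: i_def algebra_simps)
    ultimately have i2: "2 * i * s \<le> n" using n_ge by linarith
    have "real (2 * L div s * s) \<le> real (2 * L)" by (rule of_nat_mono) simp
    hence "real (2 * L div s) \<le> 2 * real L / real s" using s0 by (simp add: pos_le_divide_eq)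
    hence "real i \<le> 2 * real L / real s + 1" by (simp add: i_def)
    also have "\<dots> \<le> 2 * (r * ln (real n) / 400) / (r / 4) + 1"
      using L s r lnn by (intro add_mono frac_le) auto
    also have "\<dots> = ln (real n) / 50 + 1" using r by simp
    finally have i3: "real i \<le> ln (real n) / 50 + 1" .
    have "(1408::real) ^ i \<le> exp 11 ^ i" by (intro power_mono exp_numeric_bounds) simp
    also have "\<dots> = exp (11 * real i)" by (simp flip: exp_of_nat_mult add: mult.commute)
    also have "\<dots> \<le> exp (11 * (ln (real n) / 50 + 1))" using i3 by simp
    finally have pow: "(1408::real) ^ i \<le> exp (11 * (ln (real n) / 50 + 1))" .
    have "real (num_le L n) \<le> 1408 ^ i * real (num_le L (n - i * s))"
      using J JL sJ s4 i2 by (intro num_le_iterated_decay)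
    also have "\<dots> \<le> exp (11 * (ln (real n) / 50 + 1)) * real (num_le L (n - 2 * L))"
      using pow i1 J(1) JL by (intro mult_mono of_nat_mono num_le_mono) auto
    finally have main: "real (num_le L n) \<le> exp (11 * (ln (real n) / 50 + 1)) * real (num_le L (n - 2 * L))" .
    have "ln (real n) * real (num_le L n)
        \<le> ln (real n) * exp (11 * (ln (real n) / 50 + 1)) * real (num_le L (n - 2 * L))"
      using mult_left_mono[OF main lnn] by (simp only: mult.assoc)
    also have "\<dots> \<le> real L * real (num_le L (n - 2 * L))"
      using elim(3) L(2) unfolding r_def by (intro mult_right_mono) linarith+
    also have "\<dots> \<le> real (num_partitions n)"
      using one_large_part[of L n] n_ge JL J(1) by (simp flip: of_nat_mult)
    finally show ?case by (simp add: L_def)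
  qed
qed

text \<open>The number of partitions doubles about \<open>sqrt n / 2\<close> times below \<open>n\<close>, and \<open>exp (1 / 2) \<le> 2\<close>.\<close>

lemma num_partitions_lower_bound:
  assumes "doubling_gap n \<le> n" "1 \<le> n"
  shows "exp ((real n / (2 * sqrt n + 2) - 1) / 2) \<le> real (num_partitions n)"
proof -
  define J where "J = doubling_gap n"
  define i where "i = n div J"
  have J: "1 \<le> J" "4 * n \<le> J\<^sup>2" "real J \<le> 2 * sqrt n + 2" "J \<le> n"
    using doubling_gap_bounds[OF assms(2)] assms(1) by (simp_all add: J_def)
  have "real n / (2 * sqrt n + 2) \<le> real n / real J"
    using J by (intro divide_left_mono mult_pos_pos add_nonneg_pos) auto
  also have "\<dots> \<le> real i + 1"
  proof -
    have "n \<le> (i + 1) * J" using J(1) dividend_less_div_times[of J n] by (simp add: i_def)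
    hence "real n \<le> real ((i + 1) * J)" by (simp only: of_nat_le_iff)
    thus ?thesis using J(1) by (simp add: divide_le_eq algebra_simps)
  qed
  finally have "real n / (2 * sqrt n + 2) - 1 \<le> real i" by simp
  hence "(real n / (2 * sqrt n + 2) - 1) / 2 \<le> real i / 2" by (rule divide_right_mono) simp
  hence "(real n / (2 * sqrt n + 2) - 1) / 2 \<le> real i * (1 / 2)" by simp
  hence "exp ((real n / (2 * sqrt n + 2) - 1) / 2) \<le> exp (real i * (1 / 2))"
    by (simp only: exp_le_cancel_iff)
  also have "\<dots> = exp (1 / 2) ^ i" by (rule exp_of_nat_mult)
  also have "\<dots> \<le> 2 ^ i" by (intro power_mono exp_numeric_bounds) simp
  also have "\<dots> \<le> real (num_partitions n)"
  proof -
    have "1 \<le> num_le n (n - i * J)" using assms(2) by (rule num_le_pos)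
    hence "2 ^ i * 1 \<le> 2 ^ i * num_le n (n - i * J)" by (rule mult_le_mono2)
    also have "\<dots> \<le> num_le n n"
      using J by (intro num_le_doubling[where n = n]) (auto simp: i_def)
    finally have "2 ^ i \<le> num_partitions n" by (simp add: num_le_self)
    hence "real (2 ^ i) \<le> real (num_partitions n)" by (rule of_nat_mono)
    thus ?thesis by simp
  qed
  finally show ?thesis .
qed

text \<open>For \<open>d = core n\<close>, each term of the sum in \<open>card_small_durfee\<close> is at most
  \<open>exp (0.198 * sqrt n)\<close>, and \<open>num_partitions n\<close> is about \<open>exp (sqrt n / 4)\<close> or more.\<close>

lemma eventually_few_small_core:
  "eventually (\<lambda>n. ln (real n) *
     real (card {M \<in> mpartitions n. size (filter_mset (\<lambda>x. core n < x) M) \<le> core n})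
       \<le> real (num_partitions n)) sequentially"
proof -
  have "eventually (\<lambda>n. ln (real n) * ((real n + 1) * exp (99 / 500 * sqrt (real n)))
         \<le> exp ((real n / (2 * sqrt (real n) + 2) - 1) / 2)) sequentially"
    "eventually (\<lambda>n. 2 * sqrt (real n) + 2 \<le> real n) sequentially"
    "eventually (\<lambda>n. 1 \<le> real n) sequentially"
    by real_asymp+
  thus ?thesis
  proof eventually_elim
    case (elim n)
    define r where "r = sqrt (real n)"
    define d where "d = core n"
    define y where "y = 1 / (10 * r)"
    have n: "1 \<le> n" using elim(3) by simp
    have r: "1 \<le> r" "r * r = real n" using n by (simp_all add: r_def)
    have d: "real d \<le> r / 1000" unfolding d_def core_def r_def by (rule of_nat_floor) simp
    have y: "0 < y" using r by (simp add: y_def)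
    have "y * real d \<le> y * (r / 1000)" using y d by (intro mult_left_mono) auto
    also have "\<dots> \<le> 1" using r by (simp add: y_def)
    finally have yd: "y * real d \<le> 1" .
    define F where "F = (2 / y) ^ d / fact d"
    have F0: "0 \<le> F" using y by (simp add: F_def)
    \<comment> \<open>\<open>z ^ d / fact d\<close> is at most \<open>exp z\<close>; extracting the factor
      \<open>exp 9\<close> from the base first makes \<open>z\<close> a small multiple of \<open>r\<close>, at the price of
      \<open>exp (9 * d)\<close>, which is small because \<open>d \<le> r / 1000\<close>\<close>
    have "F = exp 9 ^ d * ((20 * r / exp 9) ^ d / fact d)"
      by (simp add: F_def y_def power_divide)
    also have "\<dots> \<le> exp (9 * (r / 1000)) * exp (r / 25)"
    proof (intro mult_mono)
      have "exp 9 ^ d = exp (real d * 9)" by (simp only: exp_of_nat_mult)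
      also have "\<dots> \<le> exp (9 * (r / 1000))" using d by simp
      finally show "exp 9 ^ d \<le> exp (9 * (r / 1000))" .
      have "20 * r / exp 9 \<le> 20 * r / 500" using exp_numeric_bounds(1) r by (intro divide_left_mono) auto
      hence "20 * r / exp 9 \<le> r / 25" by simp
      moreover have "(20 * r / exp 9) ^ d / fact d \<le> exp (20 * r / exp 9)"
        using r by (intro power_over_fact_le_exp) simp
      ultimately show "(20 * r / exp 9) ^ d / fact d \<le> exp (r / 25)"
        by (meson exp_le_cancel_iff order.trans)
    qed (use r in auto)
    also have "\<dots> = exp (49 / 1000 * r)" by (simp flip: exp_add)
    finally have F: "F \<le> exp (49 / 1000 * r)" .
    have q: "real (num_le d m) \<le> exp (y * real m) * F" for m
      unfolding F_def using y yd by (rule num_le_exp_bound)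
    have "real (num_le d j * num_le d (n - j)) \<le> exp (99 / 500 * r)" if "j \<le> n" for j
    proof -
      have "real (num_le d j * num_le d (n - j)) \<le> (exp (y * real j) * F) * (exp (y * real (n - j)) * F)"
        unfolding of_nat_mult using F0 by (intro mult_mono q) auto
      also have "\<dots> = exp (y * real n) * F * F"
        using that by (simp add: of_nat_diff right_diff_distrib exp_diff)
      also have "y * real n = r / 10" using r by (simp add: y_def flip: r(2))
      also have "exp (r / 10) * F * F \<le> exp (r / 10) * exp (49 / 1000 * r) * exp (49 / 1000 * r)"
        using F F0 by (intro mult_mono) auto
      also have "\<dots> = exp (99 / 500 * r)" by (simp flip: exp_add)
      finally show ?thesis .
    qed
    hence "(\<Sum>j\<le>n. real (num_le d j * num_le d (n - j))) \<le> (\<Sum>j\<le>n. exp (99 / 500 * r))"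
      by (intro sum_mono) simp
    hence sum: "real (\<Sum>j\<le>n. num_le d j * num_le d (n - j)) \<le> (real n + 1) * exp (99 / 500 * r)"
      by (simp add: algebra_simps)
    have "real (doubling_gap n) \<le> real n" using doubling_gap_bounds(3)[OF n] elim(2) by linarith
    hence "doubling_gap n \<le> n" by simp
    hence p: "exp ((real n / (2 * sqrt n + 2) - 1) / 2) \<le> real (num_partitions n)"
      using n by (rule num_partitions_lower_bound)
    have "real (card {M \<in> mpartitions n. size (filter_mset (\<lambda>x. d < x) M) \<le> d}) \<le> (real n + 1) * exp (99 / 500 * r)"
      using of_nat_mono[OF card_small_durfee[of n d], where 'a = real] sum by linarith
    hence "ln (real n) * real (card {M \<in> mpartitions n. size (filter_mset (\<lambda>x. d < x) M) \<le> d})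
        \<le> ln (real n) * ((real n + 1) * exp (99 / 500 * r))"
      using n by (intro mult_left_mono) auto
    also have "\<dots> \<le> real (num_partitions n)" using elim(1) p unfolding r_def by linarith
    finally show ?case by (simp add: d_def)
  qed
qed

section \<open>Disjoint hooks\<close>

text \<open>Two open arms of length \<open>L\<close> and width 1 along the positive half-axes, and an open square of side
  \<open>d\<close> at the origin.\<close>

definition hook :: "real \<Rightarrow> real \<Rightarrow> (real \<times> real) set" where
  "hook L d = {0<..<L} \<times> {0<..<1} \<union> {0<..<1} \<times> {0<..<L} \<union> {0<..<d} \<times> {0<..<d}"

lemma open_hook: "open (hook L d)"
  unfolding hook_def by (intro open_Un open_Times open_greaterThanLessThan)

lemma hook_swap: "(x, y) \<in> hook L d \<longleftrightarrow> (y, x) \<in> hook L d"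
  by (auto simp: hook_def)

text \<open>By symmetry let \<open>u\<close> lie to the left of \<open>v\<close>. If \<open>v\<close> were not above \<open>u\<close>, the horizontal arm at
  \<open>u\<close> would cross the vertical arm at \<open>v\<close>. So \<open>v\<close> lies to the upper right of \<open>u\<close>, and the two
  squares of side \<open>d\<close> would overlap if both coordinates differed by less than \<open>d\<close>.\<close>

lemma disjoint_hooks_far_apart:
  fixes u v :: "real \<times> real"
  assumes "0 < L" "0 < d"
    and near: "\<bar>fst u - fst v\<bar> < L" "\<bar>snd u - snd v\<bar> < L"
    and disj: "\<And>z. \<not> (z - u \<in> hook L d \<and> z - v \<in> hook L d)"
  shows "d \<le> \<bar>(fst u + snd u) - (fst v + snd v)\<bar>"
  using near disj
proof (induction "fst u" "fst v" arbitrary: u v rule: linorder_wlog)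
  case (le u v)
  define dx where "dx = fst v - fst u"
  define dy where "dy = snd v - snd u"
  have dx: "0 \<le> dx" "dx < L" and dy: "- L < dy" "dy < L"
    using le unfolding dx_def dy_def by auto
  have disj: "\<not> ((a, b) \<in> hook L d \<and> (a - dx, b - dy) \<in> hook L d)" for a b
  proof -
    have "u + (a, b) - u = (a, b)" "u + (a, b) - v = (a - dx, b - dy)"
      by (simp_all add: dx_def dy_def prod_eq_iff)
    thus ?thesis using le(4)[of "u + (a, b)"] by metis
  qed
  have "0 < dy"
  proof (rule ccontr)
    assume "\<not> 0 < dy"
    \<comment> \<open>the centre of the intersection of the arms, relative to \<open>u\<close>\<close>
    define a where "a = (dx + min L (dx + 1)) / 2"
    define b where "b = min 1 (dy + L) / 2"
    have "0 < a" "a < L" "0 < b" "b < 1" "0 < a - dx" "a - dx < 1" "0 < b - dy" "b - dy < L"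
      using dx dy \<open>\<not> 0 < dy\<close> \<open>0 < L\<close> by (auto simp: a_def b_def min_def)
    thus False using disj[of a b] by (simp add: hook_def)
  qed
  have "d \<le> dx + dy"
  proof (rule ccontr)
    assume "\<not> d \<le> dx + dy"
    hence "dx < d" "dy < d" using dx \<open>0 < dy\<close> by auto
    thus False using disj[of "(dx + d) / 2" "(dy + d) / 2"] dx \<open>0 < dy\<close> \<open>0 < d\<close>
      by (simp add: hook_def field_simps)
  qed
  thus ?case unfolding dx_def dy_def by linarith
next
  case (sym u v)
  have "d \<le> \<bar>fst v + snd v - (fst u + snd u)\<bar>"
    using sym(2-4) by (intro sym(1)) (auto simp: abs_minus_commute)
  thus ?case by (simp add: abs_minus_commute)
qed

text \<open>Divide the rectangle into squares of side \<open>L\<close>. A hook is determined by the square \<open>(p, q)\<close> of its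
  apex together with the integer part of \<open>s / d\<close>, where \<open>s\<close> is the sum of the apex coordinates
  relative to that square: within one square these sums differ by at least \<open>d\<close>, and they
  lie between 0 and \<open>2 * L\<close>.\<close>

lemma card_disjoint_hooks:
  fixes u :: "'a \<Rightarrow> real \<times> real"
  assumes "0 < L" "0 < d" "0 \<le> a" "0 \<le> b" "finite I"
    and inside: "\<And>i. i \<in> I \<Longrightarrow> u i \<in> cbox (x0, y0) (x0 + a, y0 + b)"
    and disj: "\<And>i j z. i \<in> I \<Longrightarrow> j \<in> I \<Longrightarrow> i \<noteq> j \<Longrightarrow> \<not> (z - u i \<in> hook L d \<and> z - u j \<in> hook L d)"
  shows "real (card I) \<le> (a / L + 1) * (b / L + 1) * (2 * L / d + 1)"
proof -
  define X where "X i = fst (u i) - x0" for i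
  define Y where "Y i = snd (u i) - y0" for i
  define p where "p i = \<lfloor>X i / L\<rfloor>" for i
  define q where "q i = \<lfloor>Y i / L\<rfloor>" for i
  define s where "s i = X i - of_int (p i) * L + (Y i - of_int (q i) * L)" for i
  define \<phi> where "\<phi> i = (p i, q i, \<lfloor>s i / d\<rfloor>)" for i
  have floor: "of_int (p i) * L \<le> X i" "X i < of_int (p i) * L + L"
      "of_int (q i) * L \<le> Y i" "Y i < of_int (q i) * L + L" for i
    using floor_divide_lower[of L "X i"] floor_divide_upper[of L "X i"]
      floor_divide_lower[of L "Y i"] floor_divide_upper[of L "Y i"] \<open>0 < L\<close>
    by (simp_all add: p_def q_def algebra_simps)
  have "inj_on \<phi> I"
  proof (rule inj_onI, rule ccontr)
    fix i j assume ij: "i \<in> I" "j \<in> I" "\<phi> i = \<phi> j" "i \<noteq> j"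
    hence eq: "p i = p j" "q i = q j" "\<lfloor>s i / d\<rfloor> = \<lfloor>s j / d\<rfloor>" by (auto simp: \<phi>_def)
    have "\<bar>X i - X j\<bar> < L" "\<bar>Y i - Y j\<bar> < L"
      using floor[of i] floor[of j] unfolding eq by linarith+
    hence "d \<le> \<bar>(fst (u i) + snd (u i)) - (fst (u j) + snd (u j))\<bar>"
      using disj[OF ij(1,2,4)] assms(1,2)
      by (intro disjoint_hooks_far_apart[where L = L]) (auto simp: X_def Y_def)
    also have "(fst (u i) + snd (u i)) - (fst (u j) + snd (u j)) = s i - s j"
      unfolding s_def X_def Y_def eq by simp
    also have "\<bar>s i - s j\<bar> < d"
      using floor_divide_lower[of d "s i"] floor_divide_upper[of d "s i"]
        floor_divide_lower[of d "s j"] floor_divide_upper[of d "s j"] \<open>0 < d\<close>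
      unfolding eq by (simp add: algebra_simps)
    finally show False by simp
  qed
  moreover have "\<phi> ` I \<subseteq> {0..\<lfloor>a / L\<rfloor>} \<times> {0..\<lfloor>b / L\<rfloor>} \<times> {0..\<lfloor>2 * L / d\<rfloor>}"
  proof (rule image_subsetI)
    fix i assume "i \<in> I"
    hence "0 \<le> X i" "X i \<le> a" "0 \<le> Y i" "Y i \<le> b"
      using inside[of i] by (cases "u i"; simp add: X_def Y_def)+
    hence "p i \<in> {0..\<lfloor>a / L\<rfloor>}" "q i \<in> {0..\<lfloor>b / L\<rfloor>}"
      using \<open>0 < L\<close> by (auto simp: p_def q_def divide_right_mono intro!: floor_mono)
    moreover have "0 \<le> s i" "s i \<le> 2 * L" using floor[of i] by (simp_all add: s_def)
    hence "\<lfloor>s i / d\<rfloor> \<in> {0..\<lfloor>2 * L / d\<rfloor>}"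
      using \<open>0 < d\<close> by (auto simp: divide_right_mono intro!: floor_mono)
    ultimately show "\<phi> i \<in> {0..\<lfloor>a / L\<rfloor>} \<times> {0..\<lfloor>b / L\<rfloor>} \<times> {0..\<lfloor>2 * L / d\<rfloor>}"
      by (simp add: \<phi>_def)
  qed
  ultimately have "card I \<le> card ({0..\<lfloor>a / L\<rfloor>} \<times> {0..\<lfloor>b / L\<rfloor>} \<times> {0..\<lfloor>2 * L / d\<rfloor>})"
    by (intro card_inj_on_le) auto
  also have "\<dots> = nat (\<lfloor>a / L\<rfloor> + 1) * (nat (\<lfloor>b / L\<rfloor> + 1) * nat (\<lfloor>2 * L / d\<rfloor> + 1))"
    by (simp add: card_cartesian_product)
  finally have "real (card I) \<le> real (nat (\<lfloor>a / L\<rfloor> + 1)) * (real (nat (\<lfloor>b / L\<rfloor> + 1)) * real (nat (\<lfloor>2 * L / d\<rfloor> + 1)))"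
    by (simp only: flip: of_nat_mult of_nat_le_iff[where 'a = real])
  also have "\<dots> \<le> (a / L + 1) * ((b / L + 1) * (2 * L / d + 1))"
  proof -
    have "real (nat (\<lfloor>t\<rfloor> + 1)) \<le> t + 1" if "0 \<le> t" for t :: real
      using that by (simp add: add.commute)
    thus ?thesis using assms by (intro mult_mono) auto
  qed
  finally show ?thesis by (simp only: mult.assoc)
qed

section \<open>Hooks in placed Ferrers shapes\<close>

lemma ferrers_shapeI:
  assumes "0 \<le> x" "0 \<le> y" "nat \<lfloor>y\<rfloor> < length xs" "nat \<lfloor>x\<rfloor> < xs ! nat \<lfloor>y\<rfloor>"
  shows "(x, y) \<in> ferrers_shape xs"
proof -
  have "(x, y) \<in> cbox (real (nat \<lfloor>x\<rfloor>), real (nat \<lfloor>y\<rfloor>)) (real (nat \<lfloor>x\<rfloor>) + 1, real (nat \<lfloor>y\<rfloor>) + 1)"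
    using assms(1,2) real_of_int_floor_add_one_ge[of x] real_of_int_floor_add_one_ge[of y] by simp
  thus ?thesis unfolding ferrers_shape_def using assms(3,4) by blast
qed

text \<open>In a decreasing list the parts larger than \<open>d\<close> form an initial segment.\<close>

lemma large_parts_first:
  assumes "sorted_wrt (\<ge>) xs" "k < size (filter_mset (\<lambda>x. d < x) (mset xs))"
  shows "k < length xs \<and> (d::nat) < xs ! k"
proof (rule ccontr)
  assume neg: "\<not> (k < length xs \<and> d < xs ! k)"
  have "\<not> d < x" if x: "x \<in> set (drop k xs)" for x
  proof -
    obtain i where "i < length (drop k xs)" "x = drop k xs ! i"
      using x unfolding in_set_conv_nth by blast
    hence i: "k + i < length xs" "x = xs ! (k + i)" by auto
    hence "x \<le> xs ! k" using sorted_wrt_nth_less[OF assms(1), of k "k + i"] by (cases i) auto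
    thus ?thesis using neg i by auto
  qed
  hence "filter (\<lambda>x. d < x) (drop k xs) = []" by (auto simp: filter_empty_conv)
  hence "filter (\<lambda>x. d < x) xs = filter (\<lambda>x. d < x) (take k xs)"
    using filter_append[of "\<lambda>x. d < x" "take k xs" "drop k xs"] by simp
  moreover have "length (filter (\<lambda>x. d < x) (take k xs)) \<le> k"
    by (rule order.trans[OF length_filter_le]) simp
  ultimately show False using assms(2) by (simp flip: mset_filter)
qed

lemma hook_subset_ferrers_shape:
  assumes xs: "xs \<in> partitions n" and "L < length xs" "\<exists>x\<in>set xs. L < x"
    and "d < size (filter_mset (\<lambda>x. d < x) (mset xs))"
  shows "hook (real L) (real d) \<subseteq> ferrers_shape xs" "(0, 0) \<in> ferrers_shape xs"
proof -
  have sorted: "sorted_wrt (\<ge>) xs" and pos: "\<And>x. x \<in> set xs \<Longrightarrow> 0 < x"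
    using xs by (auto simp: partitions_def)
  have "filter_mset (\<lambda>x. L < x) (mset xs) \<noteq> {#}" using assms(3) by auto
  hence "0 < size (filter_mset (\<lambda>x. L < x) (mset xs))" by (simp only: nonempty_has_size)
  hence first: "L < xs ! 0" using large_parts_first[OF sorted] by blast
  have col: "0 < xs ! k" if "k < length xs" for k using pos that by simp
  have sq: "k < length xs \<and> d < xs ! k" if "k \<le> d" for k
    using that assms(4) by (intro large_parts_first[OF sorted]) simp
  show "(0, 0) \<in> ferrers_shape xs" using assms(2) first by (intro ferrers_shapeI) auto
  show "hook (real L) (real d) \<subseteq> ferrers_shape xs"
  proof clarify
    have fl: "nat \<lfloor>t\<rfloor> \<le> k" if "t < real k" for t k
      using that by linarith
    have fl0: "\<lfloor>t\<rfloor> = 0" if "0 < t" "t < 1" for t :: real using that by linarith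
    fix x y assume "(x, y) \<in> hook (real L) (real d)"
    then consider "0 < x" "x < L" "0 < y" "y < 1" | "0 < x" "x < 1" "0 < y" "y < L"
      | "0 < x" "x < d" "0 < y" "y < d" by (auto simp: hook_def)
    thus "(x, y) \<in> ferrers_shape xs"
    proof cases
      case 1
      thus ?thesis using first fl[of x L] fl0[of y] assms(2) by (intro ferrers_shapeI) auto
    next
      case 2
      have "nat \<lfloor>y\<rfloor> < length xs" using fl[of y L] 2 assms(2) by linarith
      thus ?thesis using 2 fl0[of x] col by (intro ferrers_shapeI) auto
    next
      case 3
      hence "nat \<lfloor>x\<rfloor> \<le> d" "nat \<lfloor>y\<rfloor> \<le> d" using fl by auto
      thus ?thesis using 3 sq[of "nat \<lfloor>y\<rfloor>"] by (intro ferrers_shapeI) auto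
    qed
  qed
qed

text \<open>The hook is symmetric under exchanging the axes, so of the symmetry that places the shape only the two
  signs \<open>s\<close> and \<open>t\<close> matter; the apex is \<open>v\<close>.\<close>

lemma placement_contains_hook:
  assumes "is_placement xs S" "hook L d \<subseteq> ferrers_shape xs" "(0, 0) \<in> ferrers_shape xs"
  shows "\<exists>s\<in>{-1, 1}. \<exists>t\<in>{-1, 1}. \<exists>v\<in>S. \<forall>w. (s * (fst w - fst v), t * (snd w - snd v)) \<in> hook L d \<longrightarrow> w \<in> interior S"
proof -
  obtain g v where g: "g \<in> square_symmetries" and S: "S = (\<lambda>z. v + g z) ` ferrers_shape xs"
    using assms(1) by (auto simp: is_placement_def)
  obtain s t :: real where st: "s \<in> {-1, 1}" "t \<in> {-1, 1}"
    and g: "g = (\<lambda>(x, y). (s * x, t * y)) \<or> g = (\<lambda>(x, y). (s * y, t * x))"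
    using g unfolding square_symmetries_def by blast
  define H where "H = (\<lambda>w. (s * (fst w - fst v), t * (snd w - snd v))) -` hook L d"
  have "open H" unfolding H_def
    by (rule open_vimage[OF open_hook]) (intro continuous_intros)
  moreover have "H \<subseteq> S"
  proof
    fix w assume "w \<in> H"
    define x where "x = s * (fst w - fst v)"
    define y where "y = t * (snd w - snd v)"
    have xy: "(x, y) \<in> hook L d" using \<open>w \<in> H\<close> by (simp add: H_def x_def y_def)
    hence "(x, y) \<in> ferrers_shape xs" "(y, x) \<in> ferrers_shape xs"
      using assms(2) hook_swap by blast+
    moreover have "w = v + (s * x, t * y)" using st by (auto simp: x_def y_def prod_eq_iff)
    ultimately show "w \<in> S" using g unfolding S by (elim disjE) force+
  qed
  ultimately have "H \<subseteq> interior S" by (rule interior_maximal[rotated])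
  moreover have "v \<in> S"
  proof -
    have "g (0, 0) = 0" using g by (auto simp: zero_prod_def)
    thus ?thesis unfolding S by (intro image_eqI[OF _ assms(3)]) simp
  qed
  ultimately show ?thesis using st unfolding H_def by blast
qed

text \<open>For each of the four sign patterns, reflecting the plane turns all hooks with this pattern into
  translates of \<open>hook L d\<close> in the reflected rectangle.\<close>

lemma card_placed_hooks:
  assumes "0 < L" "0 < d" "0 \<le> a" "0 \<le> b" "finite I" "R = cbox (x0, y0) (x0 + a, y0 + b)"
    and sub: "\<And>i. i \<in> I \<Longrightarrow> T i \<subseteq> R"
    and disj: "\<And>i j. i \<in> I \<Longrightarrow> j \<in> I \<Longrightarrow> i \<noteq> j \<Longrightarrow> interior (T i) \<inter> interior (T j) = {}"
    and hook: "\<And>i. i \<in> I \<Longrightarrow> \<exists>s\<in>{-1, 1}. \<exists>t\<in>{-1, 1}. \<exists>v\<in>T i.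
       \<forall>w. (s * (fst w - fst v), t * (snd w - snd v)) \<in> hook L d \<longrightarrow> w \<in> interior (T i)"
  shows "real (card I) \<le> 4 * ((a / L + 1) * (b / L + 1) * (2 * L / d + 1))"
proof -
  define P where "P s t i v \<longleftrightarrow> v \<in> T i \<and>
      (\<forall>w. (s * (fst w - fst v), t * (snd w - snd v)) \<in> hook L d \<longrightarrow> w \<in> interior (T i))" for s t i v
  define J where "J = (\<lambda>(s, t). {i \<in> I. \<exists>v. P s t i v})"
  let ?K = "{-1, 1} \<times> {-1, 1} :: (real \<times> real) set"
  have bound: "real (card (J st)) \<le> (a / L + 1) * (b / L + 1) * (2 * L / d + 1)" if "st \<in> ?K" for st
  proof -
    obtain s t where st: "st = (s, t)" by force
    have st: "st = (s, t)" "s = 1 \<or> s = -1" "t = 1 \<or> t = -1" using that by (auto simp: st)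
    define v where "v i = (SOME v. P s t i v)" for i
    have v: "P s t i (v i)" if "i \<in> J st" for i
      using that unfolding v_def J_def st by (auto intro: someI)
    define u where "u i = (s * fst (v i), t * snd (v i))" for i
    show ?thesis
    proof (rule card_disjoint_hooks)
      show "u i \<in> cbox (if s = 1 then x0 else - x0 - a, if t = 1 then y0 else - y0 - b)
          ((if s = 1 then x0 else - x0 - a) + a, (if t = 1 then y0 else - y0 - b) + b)" if "i \<in> J st" for i
      proof -
        have "v i \<in> R" using v[OF that] sub that unfolding P_def J_def st by blast
        thus ?thesis using st(2,3) unfolding u_def assms(6) by (cases "v i") auto
      qed
    next
      fix i j z assume ij: "i \<in> J st" "j \<in> J st" "i \<noteq> j"
      show "\<not> (z - u i \<in> hook L d \<and> z - u j \<in> hook L d)"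
      proof
        assume z: "z - u i \<in> hook L d \<and> z - u j \<in> hook L d"
        define w where "w = (s * fst z, t * snd z)"
        have "z - u k = (s * (fst w - fst (v k)), t * (snd w - snd (v k)))" for k
          using st(2,3) by (auto simp: w_def u_def prod_eq_iff)
        hence "w \<in> interior (T i)" "w \<in> interior (T j)"
          using z v[OF ij(1)] v[OF ij(2)] unfolding P_def by metis+
        thus False using disj[of i j] ij unfolding J_def st by blast
      qed
    qed (use assms in \<open>auto simp: J_def st\<close>)
  qed
  have "I \<subseteq> (\<Union>st\<in>?K. J st)"
  proof
    fix i assume i: "i \<in> I"
    then obtain s t v where "s \<in> {-1, 1}" "t \<in> {-1, 1}" "P s t i v"
      using hook[OF i] unfolding P_def by blast
    hence "(s, t) \<in> ?K" "i \<in> J (s, t)" using i unfolding J_def prod.case by blast+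
    thus "i \<in> (\<Union>st\<in>?K. J st)" by blast
  qed
  hence "card I \<le> card (\<Union>st\<in>?K. J st)"
    using \<open>finite I\<close> by (intro card_mono) (auto simp: J_def)
  also have "\<dots> \<le> (\<Sum>st\<in>?K. card (J st))" by (rule card_UN_le) simp
  finally have "real (card I) \<le> real (\<Sum>st\<in>?K. card (J st))" by (rule of_nat_mono)
  also have "\<dots> \<le> real (card ?K) * ((a / L + 1) * (b / L + 1) * (2 * L / d + 1))"
    unfolding of_nat_sum by (rule sum_bounded_above) (rule bound)
  also have "card ?K = 4" by (simp add: card_cartesian_product)
  finally show ?thesis by simp
qed

section \<open>Areas\<close>

lemma measure_cbox_pair:
  "a \<le> b \<Longrightarrow> c \<le> d \<Longrightarrow> measure lborel (cbox (a, c) (b, d) :: (real \<times> real) set) = (b - a) * (d - c)"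
  by (simp add: content_Pair)

lemma placed_unit_box:
  assumes "g \<in> square_symmetries"
  shows "\<exists>p q. (\<lambda>z. v + g z) ` cbox (a, b) (a + 1, b + 1) = cbox (p, q) (p + 1, q + 1)"
proof -
  obtain s t :: real where st: "s \<in> {-1, 1}" "t \<in> {-1, 1}"
    and g: "g = (\<lambda>(x, y). (s * x, t * y)) \<or> g = (\<lambda>(x, y). (s * y, t * x))"
    using assms unfolding square_symmetries_def by blast
  define lo where "lo s c = (if s = 1 then c else - c - 1)" for s c :: real
  have lo: "s * x \<in> {lo s c..lo s c + 1}" if "x \<in> {c..c + 1}" "s \<in> {-1, 1}" for s x c
    using that by (auto simp: lo_def)
  have lo': "s * x \<in> {c..c + 1}" if "x \<in> {lo s c..lo s c + 1}" "s \<in> {-1, 1}" for s x c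
    using that by (auto simp: lo_def)
  obtain v1 v2 where v: "v = (v1, v2)" by force
  from g show ?thesis
  proof
    assume g: "g = (\<lambda>(x, y). (s * x, t * y))"
    have "(\<lambda>z. v + g z) ` cbox (a, b) (a + 1, b + 1)
        = cbox (v1 + lo s a, v2 + lo t b) (v1 + lo s a + 1, v2 + lo t b + 1)"
    proof (intro equalityI subsetI)
      fix w assume "w \<in> (\<lambda>z. v + g z) ` cbox (a, b) (a + 1, b + 1)"
      then obtain x y where "x \<in> {a..a + 1}" "y \<in> {b..b + 1}" "w = (v1 + s * x, v2 + t * y)"
        by (auto simp: v g)
      thus "w \<in> cbox (v1 + lo s a, v2 + lo t b) (v1 + lo s a + 1, v2 + lo t b + 1)"
        using lo[of x a s] lo[of y b t] st by auto
    next
      fix w assume w: "w \<in> cbox (v1 + lo s a, v2 + lo t b) (v1 + lo s a + 1, v2 + lo t b + 1)"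
      define x where "x = s * (fst w - v1)"
      define y where "y = t * (snd w - v2)"
      have "x \<in> {a..a + 1}" unfolding x_def using w st by (intro lo') (cases w; auto)+
      moreover have "y \<in> {b..b + 1}" unfolding y_def using w st by (intro lo') (cases w; auto)+
      moreover have "w = v + g (x, y)" using st by (auto simp: v g x_def y_def prod_eq_iff)
      ultimately show "w \<in> (\<lambda>z. v + g z) ` cbox (a, b) (a + 1, b + 1)" by auto
    qed
    thus ?thesis by blast
  next
    assume g: "g = (\<lambda>(x, y). (s * y, t * x))"
    have "(\<lambda>z. v + g z) ` cbox (a, b) (a + 1, b + 1)
        = cbox (v1 + lo s b, v2 + lo t a) (v1 + lo s b + 1, v2 + lo t a + 1)"
    proof (intro equalityI subsetI)
      fix w assume "w \<in> (\<lambda>z. v + g z) ` cbox (a, b) (a + 1, b + 1)"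
      then obtain x y where "x \<in> {a..a + 1}" "y \<in> {b..b + 1}" "w = (v1 + s * y, v2 + t * x)"
        by (auto simp: v g)
      thus "w \<in> cbox (v1 + lo s b, v2 + lo t a) (v1 + lo s b + 1, v2 + lo t a + 1)"
        using lo[of y b s] lo[of x a t] st by auto
    next
      fix w assume w: "w \<in> cbox (v1 + lo s b, v2 + lo t a) (v1 + lo s b + 1, v2 + lo t a + 1)"
      define y where "y = s * (fst w - v1)"
      define x where "x = t * (snd w - v2)"
      have "y \<in> {b..b + 1}" unfolding y_def using w st by (intro lo') (cases w; auto)+
      moreover have "x \<in> {a..a + 1}" unfolding x_def using w st by (intro lo') (cases w; auto)+
      moreover have "w = v + g (x, y)" using st by (auto simp: v g x_def y_def prod_eq_iff)
      ultimately show "w \<in> (\<lambda>z. v + g z) ` cbox (a, b) (a + 1, b + 1)" by auto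
    qed
    thus ?thesis by blast
  qed
qed

lemma placement_measure:
  assumes "xs \<in> partitions n" "is_placement xs S"
  shows "S \<in> sets lborel" "measure lborel S \<le> real n"
proof -
  obtain g v where g: "g \<in> square_symmetries" and S: "S = (\<lambda>z. v + g z) ` ferrers_shape xs"
    using assms(2) by (auto simp: is_placement_def)
  define Q where "Q = (\<lambda>(i, j). (\<lambda>z. v + g z) ` cbox (real j, real i) (real j + 1, real i + 1))"
  let ?I = "SIGMA i:{..<length xs}. {..<xs ! i}"
  have S: "S = (\<Union>ij\<in>?I. Q ij)" unfolding S ferrers_shape_def Q_def by blast
  have Q: "Q ij \<in> sets lborel \<and> measure lborel (Q ij) = 1" for ij
  proof -
    obtain i j where ij: "ij = (i, j)" by force
    obtain p q where "Q ij = cbox (p, q) (p + 1, q + 1)"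
      using placed_unit_box[OF g, of v "real j" "real i"] unfolding Q_def ij by auto
    thus ?thesis using measure_cbox_pair[of p "p + 1" q "q + 1"] by simp
  qed
  show "S \<in> sets lborel" unfolding S using Q by (intro sets.finite_UN) auto
  have "measure lborel S \<le> (\<Sum>ij\<in>?I. measure lborel (Q ij))"
    unfolding S using Q by (intro measure_UNION_le) auto
  also have "\<dots> = real (\<Sum>i<length xs. xs ! i)" using Q by simp
  also have "(\<Sum>i<length xs. xs ! i) = n"
    using assms(1) by (simp add: partitions_def sum_list_sum_nth atLeast0LessThan)
  finally show "measure lborel S \<le> real n" .
qed

section \<open>Packings contain few shapes\<close>

text \<open>The hypotheses of \<open>hook_subset_ferrers_shape\<close>: long arms in both directions and a large square.\<close>

definition spread :: "nat \<Rightarrow> nat \<Rightarrow> nat list \<Rightarrow> bool" where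
  "spread L d xs \<longleftrightarrow> L < length xs \<and> (\<exists>x\<in>set xs. L < x) \<and> d < size (filter_mset (\<lambda>x. d < x) (mset xs))"

lemma card_not_spread:
  "card {xs \<in> partitions n. \<not> spread L d xs}
    \<le> 2 * num_le L n + card {M \<in> mpartitions n. size (filter_mset (\<lambda>x. d < x) M) \<le> d}"
proof -
  let ?B = "{xs \<in> partitions n. \<not> spread L d xs}"
  let ?C = "{M \<in> mpartitions n. size (filter_mset (\<lambda>x. d < x) M) \<le> d}"
  have "inj_on mset ?B"
    using bij_betw_mset_partitions[of n] by (auto simp: bij_betw_def intro: inj_on_subset)
  hence "card ?B = card (mset ` ?B)" by (rule card_image[symmetric])
  also have "\<dots> \<le> card (parts_num L n \<union> parts_le L n \<union> ?C)"
  proof (rule card_mono)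
    show "finite (parts_num L n \<union> parts_le L n \<union> ?C)"
      using finite_parts_num finite_parts_le finite_mpartitions by simp
    show "mset ` ?B \<subseteq> parts_num L n \<union> parts_le L n \<union> ?C"
    proof (rule image_subsetI)
      fix xs assume xs: "xs \<in> ?B"
      hence "mset xs \<in> mpartitions n" using bij_betw_mset_partitions[of n] by (auto simp: bij_betw_def)
      hence M: "0 \<notin> set xs" "sum_mset (mset xs) = n" "mset xs \<in> mpartitions n" by (auto simp: mpartitions_def)
      from xs consider "length xs \<le> L" | "\<forall>x\<in>set xs. x \<le> L"
        | "size (filter_mset (\<lambda>x. d < x) (mset xs)) \<le> d" by (auto simp: spread_def not_less)
      thus "mset xs \<in> parts_num L n \<union> parts_le L n \<union> ?C"
      proof cases
        case 1 thus ?thesis using M by (simp add: parts_num_def)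
      next
        case 2
        have "set xs \<subseteq> {1..L}" using 2 M(1) by (auto simp: Suc_le_eq intro: gr0I)
        thus ?thesis using M by (simp add: parts_le_def)
      next
        case 3 thus ?thesis using M by simp
      qed
    qed
  qed
  also have "\<dots> \<le> card (parts_num L n) + num_le L n + card ?C"
    using card_Un_le[of "parts_num L n \<union> parts_le L n" ?C] card_Un_le[of "parts_num L n" "parts_le L n"]
    by linarith
  finally show ?thesis using card_parts_num_le_num_le[of L n] by linarith
qed

text \<open>By \<open>card_placed_hooks\<close>; since \<open>d \<le> L\<close> and \<open>L\<close> is at most either side of the rectangle,
  the summands 1 in its bound can be absorbed into the factors.\<close>

lemma card_spread_packing:
  assumes "0 < d" "d \<le> L" "L \<le> n" "L \<le> num_partitions n"
    and "is_rectangle (real n) (real (num_partitions n)) R" "is_packing n R A T"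
  shows "real (card {xs \<in> A. spread L d xs}) \<le> 48 * real n * real (num_partitions n) / (real L * real d)"
proof -
  define a where "a = real n"
  define b where "b = real (num_partitions n)"
  define I where "I = {xs \<in> A. spread L d xs}"
  have A: "A \<subseteq> partitions n" and pl: "\<And>xs. xs \<in> A \<Longrightarrow> is_placement xs (T xs)"
    and disj: "\<And>xs ys. xs \<in> A \<Longrightarrow> ys \<in> A \<Longrightarrow> xs \<noteq> ys \<Longrightarrow> interior (T xs) \<inter> interior (T ys) = {}"
    and sub: "\<And>xs. xs \<in> A \<Longrightarrow> T xs \<subseteq> R"
    using assms(6) by (auto simp: is_packing_def nonoverlapping_family_def)
  have hook: "\<exists>s\<in>{-1, 1}. \<exists>t\<in>{-1, 1}. \<exists>v\<in>T xs. \<forall>w.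
      (s * (fst w - fst v), t * (snd w - snd v)) \<in> hook (real L) (real d) \<longrightarrow> w \<in> interior (T xs)"
    if "xs \<in> I" for xs
  proof (rule placement_contains_hook)
    have xs: "xs \<in> partitions n" "xs \<in> A" "L < length xs" "\<exists>x\<in>set xs. L < x"
      "d < size (filter_mset (\<lambda>x. d < x) (mset xs))"
      using that A by (auto simp: I_def spread_def)
    show "is_placement xs (T xs)" using pl xs by blast
    show "hook (real L) (real d) \<subseteq> ferrers_shape xs" "(0, 0) \<in> ferrers_shape xs"
      using hook_subset_ferrers_shape[OF xs(1,3,4,5)] by blast+
  qed
  have placed: "real (card I) \<le> 4 * ((a' / real L + 1) * (b' / real L + 1) * (2 * real L / real d + 1))"
    if "R = cbox (x, y) (x + a', y + b')" "0 \<le> a'" "0 \<le> b'" for x y a' b'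
  proof (rule card_placed_hooks[where T = T, OF _ _ that(2,3) _ that(1) _ _ hook])
    show "finite I" using A finite_partitions[of n] by (auto simp: I_def intro: finite_subset)
    show "T xs \<subseteq> R" if "xs \<in> I" for xs using sub that by (simp add: I_def)
    show "interior (T xs) \<inter> interior (T ys) = {}" if "xs \<in> I" "ys \<in> I" "xs \<noteq> ys" for xs ys
      using disj that by (simp add: I_def)
  qed (use assms(1,2) in auto)
  obtain x y where "R = cbox (x, y) (x + a, y + b) \<or> R = cbox (x, y) (x + b, y + a)"
    using assms(5) by (auto simp: is_rectangle_def a_def b_def)
  hence "real (card I) \<le> 4 * ((a / real L + 1) * (b / real L + 1) * (2 * real L / real d + 1))"
    using placed[of x y a b] placed[of x y b a] by (auto simp: a_def b_def mult_ac)
  also have "\<dots> \<le> 4 * ((2 * a / real L) * (2 * b / real L) * (3 * real L / real d))"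
    using assms(1-4) by (intro mult_left_mono mult_mono) (auto simp: a_def b_def field_simps)
  also have "\<dots> = 48 * a * b / (real L * real d)"
    using assms(1,2) by (simp add: field_simps)
  finally show ?thesis by (simp add: a_def b_def I_def)
qed

lemma measure_rectangle:
  assumes "is_rectangle a b R" "0 \<le> a" "0 \<le> b"
  shows "measure lborel R = a * b"
proof -
  obtain x y where "R = cbox (x, y) (x + a, y + b) \<or> R = cbox (x, y) (x + b, y + a)"
    using assms(1) by (auto simp: is_rectangle_def)
  thus ?thesis
    using measure_cbox_pair[of x "x + a" y "y + b"] measure_cbox_pair[of x "x + b" y "y + a"] assms(2,3)
    by (auto simp: mult.commute)
qed

lemma covered_fraction_le_card:
  assumes "is_rectangle (real n) (real (num_partitions n)) R" "is_packing n R A T" "0 < n"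
  shows "covered_fraction R A T \<le> real (card A) / real (num_partitions n)"
proof -
  have A: "A \<subseteq> partitions n" and pl: "\<And>xs. xs \<in> A \<Longrightarrow> is_placement xs (T xs)"
    using assms(2) by (auto simp: is_packing_def nonoverlapping_family_def)
  have "finite A" using A finite_partitions by (rule finite_subset)
  hence "measure lborel (\<Union>xs\<in>A. T xs) \<le> (\<Sum>xs\<in>A. measure lborel (T xs))"
    using placement_measure(1)[OF _ pl] A by (intro measure_UNION_le) auto
  also have "\<dots> \<le> real (card A) * real n"
    using placement_measure(2)[OF _ pl] A by (intro sum_bounded_above) auto
  finally have "measure lborel (\<Union>xs\<in>A. T xs) \<le> real (card A) * real n" .
  hence "covered_fraction R A T \<le> real (card A) * real n / (real n * real (num_partitions n))"
    unfolding covered_fraction_def measure_rectangle[OF assms(1) of_nat_0_le_iff of_nat_0_le_iff]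
    by (rule divide_right_mono) simp
  thus ?thesis using assms(3) by simp
qed

text \<open>The last inequality turns the bound \<open>48 * n * p(n) / (L * d)\<close> of \<open>card_spread_packing\<close> into a
  multiple of \<open>p(n) / ln n\<close>; rounding costs at most the factor 4, and
  \<open>1600000 = 4 * 400 * 1000\<close>.\<close>

lemma eventually_arm_core:
  "eventually (\<lambda>n. 0 < core n \<and> core n \<le> arm n \<and> arm n \<le> n \<and> arm n \<le> num_partitions n \<and>
     real n * ln (real n) \<le> 1600000 * (real (arm n) * real (core n))) sequentially"
proof -
  have "eventually (\<lambda>n. 2 \<le> sqrt (real n) / 1000) sequentially"
    "eventually (\<lambda>n. sqrt (real n) / 1000 \<le> sqrt (real n) * ln (real n) / 400 - 1) sequentially"
    "eventually (\<lambda>n. 2 * (sqrt (real n) * ln (real n) / 400) \<le> real n) sequentially"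
    "eventually (\<lambda>n. 2 \<le> sqrt (real n) * ln (real n) / 400) sequentially"
    by real_asymp+
  thus ?thesis
  proof eventually_elim
    case (elim n)
    define r where "r = sqrt (real n)"
    have floor: "real (nat \<lfloor>x\<rfloor>) \<le> x" "x - 1 \<le> real (nat \<lfloor>x\<rfloor>)" if "0 \<le> x" for x :: real
      using of_nat_floor[OF that] real_of_int_floor_ge_diff_one[of x] that by simp_all
    have d: "real (core n) \<le> r / 1000" "r / 1000 - 1 \<le> real (core n)"
      using floor[of "r / 1000"] by (simp_all add: core_def r_def)
    have L: "real (arm n) \<le> r * ln (real n) / 400" "r * ln (real n) / 400 - 1 \<le> real (arm n)"
      using floor[of "r * ln (real n) / 400"] elim(4) by (simp_all add: arm_def r_def)
    have e: "2 \<le> r / 1000" "r / 1000 \<le> r * ln (real n) / 400 - 1" "2 * (r * ln (real n) / 400) \<le> real n"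
      "2 \<le> r * ln (real n) / 400" using elim by (simp_all add: r_def)
    have "0 < real (core n)" "real (core n) \<le> real (arm n)" "real (2 * arm n) \<le> real n"
      using d L e by simp_all
    hence c: "0 < core n" "core n \<le> arm n" "2 * arm n \<le> n" by (simp_all only: of_nat_le_iff of_nat_0_less_iff)
    have "arm n * 1 \<le> arm n * num_le (arm n) (n - 2 * arm n)"
      using c by (intro mult_le_mono2 num_le_pos) linarith
    also have "\<dots> \<le> num_partitions n" using c by (intro one_large_part) auto
    finally have p: "arm n \<le> num_partitions n" by simp
    have "real n * ln (real n) = 1600000 * ((r * ln (real n) / 800) * (r / 2000))"
      by (simp add: r_def field_simps flip: power2_eq_square)
    also have "\<dots> \<le> 1600000 * (real (arm n) * real (core n))"
      using L d e by (intro mult_left_mono mult_mono) auto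
    finally show ?case using c p by simp
  qed
qed

theorem theorem1:
  "\<exists>c::real. c > 0 \<and> (\<exists>n0::nat. \<forall>n\<ge>n0. \<forall>R.
     is_rectangle (real n) (real (num_partitions n)) R \<longrightarrow>
       (\<nexists>T. is_tiling n R T) \<and>
       (\<forall>A T. is_packing n R A T \<longrightarrow> covered_fraction R A T \<le> c / ln (real n)))"
proof -
  \<comment> \<open>\<open>48 * 1600000\<close> for the spread partitions and 3 for the others\<close>
  define c :: real where "c = 76800003"
  have "eventually (\<lambda>n. c < ln (real n)) sequentially" by real_asymp
  with eventually_few_short eventually_few_small_core eventually_arm_core
  have "eventually (\<lambda>n. \<forall>R. is_rectangle (real n) (real (num_partitions n)) R \<longrightarrow>
       (\<nexists>T. is_tiling n R T) \<and>
       (\<forall>A T. is_packing n R A T \<longrightarrow> covered_fraction R A T \<le> c / ln (real n))) sequentially"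
  proof eventually_elim
    case (elim n)
    define p where "p = real (num_partitions n)"
    define l where "l = ln (real n)"
    define D where "D = card {M \<in> mpartitions n. size (filter_mset (\<lambda>x. core n < x) M) \<le> core n}"
    have l: "0 < l" "c < l" using elim(4) by (simp_all add: l_def c_def)
    have n: "0 < n" and p: "0 < p" using elim(3) by (auto simp: p_def)
    have packing: "covered_fraction R A T \<le> c / l"
      if R: "is_rectangle (real n) (real (num_partitions n)) R" and A: "is_packing n R A T" for R A T
    proof -
      let ?G = "{xs \<in> A. spread (arm n) (core n) xs}"
      let ?B = "{xs \<in> partitions n. \<not> spread (arm n) (core n) xs}"
      have A': "A \<subseteq> partitions n" using A by (auto simp: is_packing_def nonoverlapping_family_def)
      hence "A \<subseteq> ?G \<union> ?B" by blast
      hence "card A \<le> card (?G \<union> ?B)"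
        using A' finite_partitions[of n] by (intro card_mono) (auto intro: finite_subset)
      also have "\<dots> \<le> card ?G + card ?B" by (rule card_Un_le)
      also have "card ?B \<le> 2 * num_le (arm n) n + D"
        unfolding D_def by (rule card_not_spread)
      finally have "real (card A) \<le> real (card ?G + (2 * num_le (arm n) n + D))"
        by (simp only: of_nat_le_iff)
      hence card_A: "real (card A) \<le> real (card ?G) + 2 * real (num_le (arm n) n) + real D" by simp
      have "real (num_le (arm n) n) \<le> p / l" using elim(1) l by (simp add: p_def l_def field_simps)
      moreover have "real D \<le> p / l" using elim(2) l by (simp add: p_def l_def D_def field_simps)
      moreover have "real (card ?G) \<le> 76800000 * (p / l)"
      proof -
        define q where "q = real (arm n) * real (core n)"
        have "0 < q" using elim(3) by (simp add: q_def)
        have "real (card ?G) \<le> 48 * real n * p / q"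
          unfolding p_def q_def using elim(3) R A by (intro card_spread_packing) auto
        also have "\<dots> \<le> 76800000 * (p / l)"
        proof -
          have "real n * l * (48 * p) \<le> 1600000 * q * (48 * p)"
            using elim(3) p by (intro mult_right_mono) (auto simp: l_def q_def)
          thus ?thesis using l(1) \<open>0 < q\<close> by (simp add: field_simps)
        qed
        finally show ?thesis .
      qed
      ultimately have "real (card A) \<le> c * (p / l)" using card_A by (simp add: c_def)
      hence "real (card A) / p \<le> c / l" using p by (simp add: field_simps)
      thus ?thesis using covered_fraction_le_card[OF R A n] by (simp add: p_def)
    qed
    have "\<not> is_tiling n R T" if R: "is_rectangle (real n) (real (num_partitions n)) R" for R T
    proof
      assume T: "is_tiling n R T"
      hence U: "(\<Union>xs\<in>partitions n. T xs) = R" by (simp add: is_tiling_def)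
      hence "is_packing n R (partitions n) T" using T by (auto simp: is_packing_def is_tiling_def)
      hence "covered_fraction R (partitions n) T \<le> c / l" by (rule packing[OF R])
      moreover have "covered_fraction R (partitions n) T = 1"
        using measure_rectangle[OF R] n p by (simp add: covered_fraction_def U p_def)
      ultimately show False using l by (simp add: field_simps)
    qed
    thus ?case using packing by (auto simp: l_def)
  qed
  then obtain n0 where "\<forall>n\<ge>n0. \<forall>R. is_rectangle (real n) (real (num_partitions n)) R \<longrightarrow>
       (\<nexists>T. is_tiling n R T) \<and>
       (\<forall>A T. is_packing n R A T \<longrightarrow> covered_fraction R A T \<le> c / ln (real n))"
    unfolding eventually_sequentially by blast
  moreover have "0 < c" by (simp add: c_def)
  ultimately show ?thesis by blast
qed

end
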